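(* Let $E$ be a perfectly self-similar second-countable Stone space. Every element of $\mathrm{Homeo}(E)$ that permutes the maximally stable points of $E$ nontrivially normally generates $\mathrm{Homeo}(E)$. In particular, $\mathrm{Homeo}(2^{\mathbb{N}})$ is simple, where $2^{\mathbb N}$ is the Cantor set.
   Context: A Stone space is a compact zero-dimensional Hausdorff space. A 2-manifold is a connected second-countable Hausdorff space in which every point has an open neighborhood homeomorphic to $\mathbb{R}^2$; it is planar if it is homeomorphic to an open subset of $\mathbb{R}^2$. A subset $K$ of a 2-manifold $M$ is displaceable if there is a homeomorphism $f\colon M\to M$ with $f(K)\cap K=\varnothing$. $M$ is self-similar if every proper compact subset of $M$ is displaceable and, for every separating simple closed curve $c$ in $M$, some component of $M\smallsetminus c$ is homeomorphic to $M$ with a point removed; it is perfectly self-similar if moreover $M\# M$ is homeomorphic to $M$. A second-countable Stone space $E$ is perfectly self-similar if it is homeomorphic to the space of ends of a planar perfectly self-similar 2-manifold. A point $e\in E$ is maximally stable if it has a neighborhood basis consisting of pairwise homeomorphic clopen subsets of $E$, one of which is $E$ itself. $\mathrm{Homeo}(E)$ is the group of all homeomorphisms $E\to E$. An element normally generates a group if the smallest normal subgroup containing it is the whole group. *)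

theory Defs
  imports "HOL-Analysis.Analysis" "HOL-Algebra.Coset" "HOL-Algebra.Bij"
begin

section \<open>2-manifolds\<close>

text \<open>The library's \<^const>\<open>connected_space\<close> holds of the empty space, which is excluded here.\<close>

definition two_manifold :: "'a topology \<Rightarrow> bool" where
  "two_manifold M \<longleftrightarrow>
     topspace M \<noteq> {} \<and> connected_space M \<and> second_countable M \<and> Hausdorff_space M \<and>
     (\<forall>x \<in> topspace M. \<exists>U. openin M U \<and> x \<in> U \<and>
        subtopology M U homeomorphic_space (euclidean :: (real^2) topology))"

definition planar :: "'a topology \<Rightarrow> bool" where
  "planar M \<longleftrightarrow> (\<exists>U :: (real^2) set. open U \<and> M homeomorphic_space top_of_set U)"

definition displaceable :: "'a topology \<Rightarrow> 'a set \<Rightarrow> bool" where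
  "displaceable M K \<longleftrightarrow> (\<exists>f. homeomorphic_map M M f \<and> f ` K \<inter> K = {})"

definition simple_closed_curve_in :: "'a topology \<Rightarrow> 'a set \<Rightarrow> bool" where
  "simple_closed_curve_in M c \<longleftrightarrow>
     c \<subseteq> topspace M \<and> subtopology M c homeomorphic_space top_of_set (sphere (0 :: real^2) 1)"

definition separating :: "'a topology \<Rightarrow> 'a set \<Rightarrow> bool" where
  "separating M c \<longleftrightarrow> \<not> connected_space (subtopology M (topspace M - c))"

definition self_similar :: "'a topology \<Rightarrow> bool" where
  "self_similar M \<longleftrightarrow>
     (\<forall>K. compactin M K \<and> K \<noteq> topspace M \<longrightarrow> displaceable M K) \<and>
     (\<forall>c. simple_closed_curve_in M c \<and> separating M c \<longrightarrow>
        (\<exists>C \<in> connected_components_of (subtopology M (topspace M - c)).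
         \<exists>p \<in> topspace M.
           subtopology M C homeomorphic_space subtopology M (topspace M - {p})))"

text \<open>
  \<open>N\<close> is a connected sum of \<open>M1\<close> and \<open>M2\<close>: remove from each the interior of an embedded closed
  disk and glue the remaining spaces along the two boundary circles. In dimension two every
  embedded closed disk has a collared boundary (Schoenflies), so no tameness condition on the
  embeddings is needed. The index \<^const>\<open>True\<close> marks points of \<open>M1\<close>, \<^const>\<open>False\<close> points of
  \<open>M2\<close>, so that \<open>M1 = M2\<close> gives two disjoint copies. The property is invariant under
  homeomorphism of \<open>N\<close>.
\<close>

definition is_connected_sum :: "'a topology \<Rightarrow> 'a topology \<Rightarrow> 'b topology \<Rightarrow> bool" where
  "is_connected_sum M1 M2 N \<longleftrightarrow>
     (\<exists>\<phi> \<psi> q.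
        embedding_map (top_of_set (cball (0 :: real^2) 1)) M1 \<phi> \<and>
        embedding_map (top_of_set (cball (0 :: real^2) 1)) M2 \<psi> \<and>
        (let S = sum_topology
                   (\<lambda>b. if b then subtopology M1 (topspace M1 - \<phi> ` ball 0 1)
                        else subtopology M2 (topspace M2 - \<psi> ` ball 0 1)) (UNIV :: bool set)
         in quotient_map S N q \<and>
            (\<forall>x \<in> topspace S. \<forall>y \<in> topspace S.
               q x = q y \<longleftrightarrow>
                 x = y \<or> (\<exists>z \<in> sphere 0 1. {x, y} = {(True, \<phi> z), (False, \<psi> z)}))))"

definition perfectly_self_similar :: "'a topology \<Rightarrow> bool" where
  "perfectly_self_similar M \<longleftrightarrow>
     self_similar M \<and>
     (\<exists>N :: 'a topology. is_connected_sum M M N \<and> N homeomorphic_space M)"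

section \<open>The space of ends\<close>

text \<open>
  The inverse limit, over the compact subsets \<open>K\<close> of \<open>M\<close> ordered by inclusion, of the discrete
  spaces of components of \<open>M - K\<close>. An end \<open>e\<close> chooses a component \<open>e K\<close> for every compact \<open>K\<close>;
  compatibility of the choices forces every \<open>e K\<close> to have non-compact closure.
\<close>

definition end_space :: "'a topology \<Rightarrow> ('a set \<Rightarrow> 'a set) topology" where
  "end_space M =
     subtopology
       (product_topology
          (\<lambda>K. discrete_topology (connected_components_of (subtopology M (topspace M - K))))
          {K. compactin M K})
       {e. \<forall>K L. compactin M K \<and> compactin M L \<and> K \<subseteq> L \<longrightarrow> e L \<subseteq> e K}"

section \<open>Stone spaces\<close>

definition stone_space :: "'a topology \<Rightarrow> bool" where
  "stone_space E \<longleftrightarrow>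
     compact_space E \<and> Hausdorff_space E \<and>
     neighbourhood_base_of (\<lambda>U. closedin E U \<and> openin E U) E"

text \<open>
  Since a planar manifold is homeomorphic to an open subset of the plane, letting \<open>M\<close> range over
  topologies whose points are taken from \<^typ>\<open>real^2\<close> loses no generality.
\<close>

definition perfectly_self_similar_stone_space :: "'a topology \<Rightarrow> bool" where
  "perfectly_self_similar_stone_space E \<longleftrightarrow>
     stone_space E \<and> second_countable E \<and>
     (\<exists>M :: (real^2) topology.
        two_manifold M \<and> planar M \<and> perfectly_self_similar M \<and> E homeomorphic_space end_space M)"

definition maximally_stable :: "'a topology \<Rightarrow> 'a \<Rightarrow> bool" where
  "maximally_stable E e \<longleftrightarrow>
     e \<in> topspace E \<and>
     (\<exists>\<B>. (\<forall>B \<in> \<B>. closedin E B \<and> openin E B \<and> e \<in> B) \<and>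
          (\<forall>W. openin E W \<and> e \<in> W \<longrightarrow> (\<exists>B \<in> \<B>. B \<subseteq> W)) \<and>
          (\<forall>B \<in> \<B>. \<forall>B' \<in> \<B>. subtopology E B homeomorphic_space subtopology E B') \<and>
          topspace E \<in> \<B>)"

definition cantor_space :: "(nat \<Rightarrow> bool) topology" where
  "cantor_space = product_topology (\<lambda>_. discrete_topology UNIV) UNIV"

section \<open>Homeomorphism groups\<close>

text \<open>
  As in \<^const>\<open>BijGroup\<close>, elements are extensional, so that maps agreeing on \<^term>\<open>topspace E\<close>
  are equal.
\<close>

definition homeo_group :: "'a topology \<Rightarrow> ('a \<Rightarrow> 'a) monoid" where
  "homeo_group E =
     BijGroup (topspace E) \<lparr>carrier := {f \<in> Bij (topspace E). homeomorphic_map E E f}\<rparr>"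

lemma subgroup_homeo_group:
  "subgroup {f \<in> Bij (topspace E). homeomorphic_map E E f} (BijGroup (topspace E))"
proof -
  interpret group "BijGroup (topspace E)"
    by (rule group_BijGroup)
  show ?thesis
  proof (rule subgroupI)
    show "{f \<in> Bij (topspace E). homeomorphic_map E E f} \<subseteq> carrier (BijGroup (topspace E))"
      by (auto simp: BijGroup_def)
    have "homeomorphic_map E E (\<lambda>x\<in>topspace E. x)"
      by (rule homeomorphic_map_eq [of E E id]) auto
    then show "{f \<in> Bij (topspace E). homeomorphic_map E E f} \<noteq> {}"
      using id_Bij by blast
  next
    fix f assume f: "f \<in> {f \<in> Bij (topspace E). homeomorphic_map E E f}"
    then obtain g where g: "homeomorphic_maps E E f g"
      by (auto simp: homeomorphic_map_maps)
    have "homeomorphic_map E E g"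
      using g homeomorphic_maps_map by blast
    moreover have "g x = (\<lambda>x\<in>topspace E. inv_into (topspace E) f x) x" if "x \<in> topspace E" for x
      using g f that
      by (smt (verit, ccfv_SIG) homeomorphic_maps_map homeomorphic_imp_injective_map
          homeomorphic_imp_surjective_map imageI inv_into_f_eq restrict_apply')
    ultimately have "homeomorphic_map E E (\<lambda>x\<in>topspace E. inv_into (topspace E) f x)"
      using homeomorphic_map_eq by blast
    then show "inv\<^bsub>BijGroup (topspace E)\<^esub> f \<in> {f \<in> Bij (topspace E). homeomorphic_map E E f}"
      using f by (simp add: inv_BijGroup restrict_inv_into_Bij)
  next
    fix f g assume "f \<in> {f \<in> Bij (topspace E). homeomorphic_map E E f}"
      "g \<in> {f \<in> Bij (topspace E). homeomorphic_map E E f}"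
    then have "f \<in> Bij (topspace E)" "g \<in> Bij (topspace E)"
      "homeomorphic_map E E (f \<circ> g)"
      using homeomorphic_map_compose by auto
    moreover from this have "homeomorphic_map E E (compose (topspace E) f g)"
      by (auto intro: homeomorphic_map_eq simp: compose_def)
    ultimately show "f \<otimes>\<^bsub>BijGroup (topspace E)\<^esub> g
        \<in> {f \<in> Bij (topspace E). homeomorphic_map E E f}"
      by (simp add: BijGroup_def compose_Bij)
  qed
qed

lemma group_homeo_group: "group (homeo_group E)"
  unfolding homeo_group_def
  by (rule subgroup.subgroup_is_group [OF subgroup_homeo_group group_BijGroup])

definition normal_closure :: "('a, 'b) monoid_scheme \<Rightarrow> 'a set \<Rightarrow> 'a set" where
  "normal_closure G S = \<Inter> {N. N \<lhd> G \<and> S \<subseteq> N}"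

definition normally_generates :: "('a, 'b) monoid_scheme \<Rightarrow> 'a \<Rightarrow> bool" where
  "normally_generates G g \<longleftrightarrow> g \<in> carrier G \<and> normal_closure G {g} = carrier G"

text \<open>
  The locale \<open>simple_group\<close> of HOL-Algebra demands \<open>order G > 1\<close>, which fails for infinite
  groups because \<^const>\<open>card\<close> is then 0; hence a definition covering infinite groups.
\<close>

definition is_simple_group :: "('a, 'b) monoid_scheme \<Rightarrow> bool" where
  "is_simple_group G \<longleftrightarrow>
     group G \<and> carrier G \<noteq> {\<one>\<^bsub>G\<^esub>} \<and> (\<forall>N. N \<lhd> G \<longrightarrow> N = carrier G \<or> N = {\<one>\<^bsub>G\<^esub>})"

end

theory Submission
  imports Defs
begin

text \<open>
  Let \<open>E\<close> be Hausdorff and first countable and let the homeomorphism \<open>f\<close> move a maximally stable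
  point \<open>e\<close>. A small clopen neighbourhood \<open>L\<close> of \<open>e\<close> and its image
  \<open>f L\<close> are then disjoint clopen copies of \<open>E\<close>. Hence \<open>L - {e}\<close> splits into infinitely many shells
  converging to \<open>e\<close>, each containing a copy of \<open>E\<close>, and an infinite shift towards \<open>e\<close> shows that
  every clopen set containing a clopen copy of \<open>E\<close> is itself a copy. Now Anderson's argument applies:
  every homeomorphism supported on a copy of \<open>E\<close> whose complement is also a copy is, up to
  conjugation, a commutator \<open>[G, \<phi>] = [[G, f], \<phi>]\<close> with \<open>G\<close> and \<open>\<phi>\<close> supported on \<open>L\<close>, and every homeomorphism is a product of
  two such. In the Cantor set every point is maximally stable, so simplicity follows.
\<close>

section \<open>Gluing homeomorphisms along clopen sets\<close>

definition clopenin :: "'a topology \<Rightarrow> 'a set \<Rightarrow> bool" where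
  "clopenin X A \<longleftrightarrow> closedin X A \<and> openin X A"

lemma clopenin_subset: "clopenin X A \<Longrightarrow> A \<subseteq> topspace X"
  by (simp add: clopenin_def openin_subset)

lemma clopenin_topspace [simp]: "clopenin X (topspace X)"
  by (simp add: clopenin_def)

lemma clopenin_Diff: "clopenin X A \<Longrightarrow> clopenin X B \<Longrightarrow> clopenin X (A - B)"
  by (simp add: clopenin_def closedin_diff openin_diff)

lemma clopenin_Un: "clopenin X A \<Longrightarrow> clopenin X B \<Longrightarrow> clopenin X (A \<union> B)"
  by (simp add: clopenin_def closedin_Un openin_Un)

lemma clopenin_Int: "clopenin X A \<Longrightarrow> clopenin X B \<Longrightarrow> clopenin X (A \<inter> B)"
  by (simp add: clopenin_def closedin_Int openin_Int)

lemma clopenin_subtopology: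
  assumes "clopenin X S"
  shows "clopenin (subtopology X S) A \<longleftrightarrow> clopenin X A \<and> A \<subseteq> S"
  using assms by (auto simp: clopenin_def openin_open_subtopology closedin_closed_subtopology)

lemma clopenin_homeomorphic_image:
  assumes "homeomorphic_map X Y h" "clopenin X A"
  shows "clopenin Y (h ` A)"
  using assms homeomorphic_map_openness_eq homeomorphic_map_closedness_eq
  unfolding clopenin_def by blast

text \<open>Serves to push a clopen piece \<open>B\<close> into a copy \<open>A\<close> of the whole
  space. A set that is clopen in the clopen subspace \<open>A\<close> is clopen in \<open>X\<close>,
  so the smaller piece can again be used for gluing.\<close>

lemma clopenin_homeomorphic_image_subtopology:
  assumes "homeomorphic_map X (subtopology X A) h" "clopenin X A" "clopenin X B"
  shows "clopenin X (h ` B)" and "h ` B \<subseteq> A"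
    and "homeomorphic_map (subtopology X B) (subtopology X (h ` B)) h"
proof -
  show "clopenin X (h ` B)" "h ` B \<subseteq> A"
    using clopenin_homeomorphic_image [OF assms(1,3)] clopenin_subtopology [OF assms(2)] by auto
  then show "homeomorphic_map (subtopology X B) (subtopology X (h ` B)) h"
    using homeomorphic_map_subtopologies [OF assms(1), of B "h ` B"] clopenin_subset [OF assms(3)]
      homeomorphic_imp_surjective_map [OF assms(1)]
    by (auto simp: subtopology_subtopology Int_absorb1)
qed

text \<open>Continuity is automatic on the open blocks, even when there are infinitely many. Only
  the possible leftover point \<open>a\<close> needs an argument, and there \<open>conv\<close> says
  that all but finitely many blocks are mapped close to \<open>h a\<close>.\<close>

lemma continuous_map_blocks:
  assumes clo: "\<And>i. i \<in> I \<Longrightarrow> clopenin X (A i)"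
    and cont: "\<And>i. i \<in> I \<Longrightarrow> continuous_map (subtopology X (A i)) Y h"
    and rest: "topspace X - \<Union>(A ` I) \<subseteq> {a}" "h ` (topspace X - \<Union>(A ` I)) \<subseteq> topspace Y"
    and conv: "\<And>V. a \<in> topspace X - \<Union>(A ` I) \<Longrightarrow> openin Y V \<Longrightarrow> h a \<in> V \<Longrightarrow> finite {i \<in> I. \<not> h ` A i \<subseteq> V}"
  shows "continuous_map X Y h"
proof -
  have sub: "A i \<subseteq> topspace X" if "i \<in> I" for i
    using clo [OF that] clopenin_subset by blast
  have pre: "openin X {x \<in> A i. h x \<in> V}" if "i \<in> I" "openin Y V" for i V
  proof -
    have "openin (subtopology X (A i)) {x \<in> topspace (subtopology X (A i)). h x \<in> V}"
      using cont that openin_continuous_map_preimage by blast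
    moreover have "topspace (subtopology X (A i)) = A i"
      using sub that by (auto simp: Int_absorb1)
    ultimately have "openin (subtopology X (A i)) {x \<in> A i. h x \<in> V}"
      by (metis (no_types))
    then show ?thesis
      using clo that by (simp add: openin_open_subtopology clopenin_def)
  qed
  have maps: "h x \<in> topspace Y" if "x \<in> topspace X" for x
  proof (cases "x \<in> \<Union>(A ` I)")
    case True
    then obtain i where "i \<in> I" "x \<in> A i" by auto
    then show ?thesis
      using cont [of i] that by (auto simp: continuous_map_def)
  next
    case False
    then show ?thesis using rest(2) that by blast
  qed
  have "openin X {x \<in> topspace X. h x \<in> V}" if V: "openin Y V" for V
  proof (cases "a \<in> topspace X - \<Union>(A ` I) \<and> h a \<in> V")
    case True
    \<comment> \<open>Points outside the preimage of \<open>V\<close> can only lie in blocks with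
      index in \<open>J\<close>. As \<open>J\<close> is finite, the complement of the preimage is a
      finite union of closed sets.\<close>
    define J where "J = {i \<in> I. \<not> h ` A i \<subseteq> V}"
    have fin: "finite J"
      using True conv V by (simp add: J_def)
    have "closedin X (A i - {x \<in> A i. h x \<in> V})" if "i \<in> J" for i
      using that clo pre [OF _ V] by (auto simp: J_def clopenin_def)
    then have "closedin X (\<Union>i\<in>J. A i - {x \<in> A i. h x \<in> V})"
      using fin by (intro closedin_Union) auto
    then have "openin X (topspace X - (\<Union>i\<in>J. A i - {x \<in> A i. h x \<in> V}))"
      by blast
    moreover have "h x \<in> V" if "x \<in> topspace X" "x \<notin> \<Union>(A ` I)" for x
      using True rest(1) that by auto
    then have "h x \<in> V" if "x \<in> topspace X" "\<forall>i\<in>J. x \<notin> A i - {x \<in> A i. h x \<in> V}" for x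
      using that unfolding J_def by (cases "x \<in> \<Union>(A ` I)") blast+
    then have "topspace X - (\<Union>i\<in>J. A i - {x \<in> A i. h x \<in> V}) = {x \<in> topspace X. h x \<in> V}"
      by blast
    ultimately show ?thesis by simp
  next
    case False
    have "x \<in> \<Union>(A ` I)" if "x \<in> topspace X" "h x \<in> V" for x
      using False rest(1) that by auto
    then have "{x \<in> topspace X. h x \<in> V} = (\<Union>i\<in>I. {x \<in> A i. h x \<in> V})"
      using sub by auto
    then show ?thesis
      using pre [OF _ V] by auto
  qed
  then show ?thesis
    using maps by (auto simp: continuous_map_def)
qed

text \<open>
  The remainders \<open>P\<close> and \<open>Q\<close> are either both empty or single points to which the blocks converge.
\<close>

lemma homeomorphic_map_blocks:
  assumes A: "\<And>i. i \<in> I \<Longrightarrow> clopenin X (A i)" "disjoint_family_on A I"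
      "topspace X = P \<union> \<Union>(A ` I)" "P \<inter> \<Union>(A ` I) = {}" "P \<subseteq> {a}"
    and B: "\<And>i. i \<in> I \<Longrightarrow> clopenin Y (B i)" "disjoint_family_on B I"
      "topspace Y = Q \<union> \<Union>(B ` I)" "Q \<inter> \<Union>(B ` I) = {}" "Q \<subseteq> {b}"
    and PQ: "P = {} \<longleftrightarrow> Q = {}"
    and hom: "\<And>i. i \<in> I \<Longrightarrow> homeomorphic_map (subtopology X (A i)) (subtopology Y (B i)) (h i)"
    and convA: "\<And>V. P \<noteq> {} \<Longrightarrow> openin X V \<Longrightarrow> a \<in> V \<Longrightarrow> finite {i \<in> I. \<not> A i \<subseteq> V}"
    and convB: "\<And>V. P \<noteq> {} \<Longrightarrow> openin Y V \<Longrightarrow> b \<in> V \<Longrightarrow> finite {i \<in> I. \<not> B i \<subseteq> V}"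
  obtains F where "homeomorphic_map X Y F" "\<And>i x. i \<in> I \<Longrightarrow> x \<in> A i \<Longrightarrow> F x = h i x"
    "P \<noteq> {} \<Longrightarrow> F a = b"
proof -
  have "\<exists>g. \<forall>i\<in>I. homeomorphic_maps (subtopology X (A i)) (subtopology Y (B i)) (h i) (g i)"
    using hom by (intro bchoice) (auto simp: homeomorphic_map_maps)
  then obtain g where
    hg: "\<And>i. i \<in> I \<Longrightarrow> homeomorphic_maps (subtopology X (A i)) (subtopology Y (B i)) (h i) (g i)"
    by blast
  have topA: "topspace (subtopology X (A i)) = A i" if "i \<in> I" for i
    using A(3) that by auto
  have topB: "topspace (subtopology Y (B i)) = B i" if "i \<in> I" for i
    using B(3) that by auto
  \<comment> \<open>Disjointness of the blocks makes the choice of \<open>i\<close> unique. The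
    default \<open>b\<close> is taken, inside the space, only at the point of \<open>P\<close>, if
    there is one; \<open>G\<close> is built symmetrically as the inverse.\<close>
  define F where "F x = (if x \<in> \<Union>(A ` I) then h (SOME i. i \<in> I \<and> x \<in> A i) x else b)" for x
  define G where "G y = (if y \<in> \<Union>(B ` I) then g (SOME i. i \<in> I \<and> y \<in> B i) y else a)" for y
  have F: "F x = h i x" if "i \<in> I" "x \<in> A i" for i x
  proof -
    have "(SOME i. i \<in> I \<and> x \<in> A i) = i"
      using that A(2) by (intro some_equality) (auto simp: disjoint_family_on_def)
    then show ?thesis using that by (auto simp: F_def)
  qed
  have G: "G y = g i y" if "i \<in> I" "y \<in> B i" for i y
  proof -
    have "(SOME i. i \<in> I \<and> y \<in> B i) = i"
      using that B(2) by (intro some_equality) (auto simp: disjoint_family_on_def)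
    then show ?thesis using that by (auto simp: G_def)
  qed
  have cF: "continuous_map (subtopology X (A i)) (subtopology Y (B i)) F" if "i \<in> I" for i
    by (rule continuous_map_eq [of _ _ "h i"])
      (use hg [OF that] F that topA in \<open>auto simp: homeomorphic_maps_def\<close>)
  have cG: "continuous_map (subtopology Y (B i)) (subtopology X (A i)) G" if "i \<in> I" for i
    by (rule continuous_map_eq [of _ _ "g i"])
      (use hg [OF that] G that topB in \<open>auto simp: homeomorphic_maps_def\<close>)
  have FB: "F x \<in> B i" if "i \<in> I" "x \<in> A i" for i x
    using cF [OF that(1)] that topA topB by (auto simp: continuous_map_def)
  have GA: "G y \<in> A i" if "i \<in> I" "y \<in> B i" for i y
    using cG [OF that(1)] that topA topB by (auto simp: continuous_map_def)
  have Fa: "F a = b" if "P \<noteq> {}"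
    using that A(4,5) by (auto simp: F_def)
  have Gb: "G b = a" if "P \<noteq> {}"
    using that B(4,5) PQ by (auto simp: G_def)
  have "continuous_map X Y F"
  proof (rule continuous_map_blocks [where I = I and A = A and a = a])
    show "continuous_map (subtopology X (A i)) Y F" if "i \<in> I" for i
      using cF that continuous_map_into_fulltopology by blast
    have "topspace X - \<Union>(A ` I) = P"
      using A(3,4) by blast
    moreover have "F ` P \<subseteq> Q"
      using Fa PQ A(5) B(5) by auto
    ultimately show "topspace X - \<Union>(A ` I) \<subseteq> {a}" "F ` (topspace X - \<Union>(A ` I)) \<subseteq> topspace Y"
      using A(5) B(3) by auto
    fix V assume a: "a \<in> topspace X - \<Union>(A ` I)" and V: "openin Y V" "F a \<in> V"
    have "finite {i \<in> I. \<not> B i \<subseteq> V}"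
      using a V convB A(3) Fa by fastforce
    then show "finite {i \<in> I. \<not> F ` A i \<subseteq> V}"
      by (rule rev_finite_subset) (use FB in auto)
  qed (use A in auto)
  moreover have "continuous_map Y X G"
  proof (rule continuous_map_blocks [where I = I and A = B and a = b])
    show "continuous_map (subtopology Y (B i)) X G" if "i \<in> I" for i
      using cG that continuous_map_into_fulltopology by blast
    have "topspace Y - \<Union>(B ` I) = Q"
      using B(3,4) by blast
    moreover have "G ` Q \<subseteq> P"
      using Gb PQ A(5) B(5) by auto
    ultimately show "topspace Y - \<Union>(B ` I) \<subseteq> {b}" "G ` (topspace Y - \<Union>(B ` I)) \<subseteq> topspace X"
      using B(5) A(3) by auto
    fix V assume b: "b \<in> topspace Y - \<Union>(B ` I)" and V: "openin X V" "G b \<in> V"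
    have "finite {i \<in> I. \<not> A i \<subseteq> V}"
      using b V convA B(3) Gb PQ by fastforce
    then show "finite {i \<in> I. \<not> G ` B i \<subseteq> V}"
      by (rule rev_finite_subset) (use GA in auto)
  qed (use B in auto)
  moreover have "G (F x) = x" if "x \<in> topspace X" for x
  proof (cases "x \<in> P")
    case True
    then show ?thesis using Fa Gb A(5) by auto
  next
    case False
    then have "x \<in> \<Union>(A ` I)" using A(3) that by auto
    then obtain i where i: "i \<in> I" "x \<in> A i" by auto
    then have "G (F x) = g i (h i x)" using F [OF i] G [OF i(1) FB [OF i]] by simp
    then show ?thesis using hg [OF i(1)] i topA by (auto simp: homeomorphic_maps_def)
  qed
  moreover have "F (G y) = y" if "y \<in> topspace Y" for y
  proof (cases "y \<in> Q")
    case True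
    then have "y = b" "P \<noteq> {}" using B(5) PQ by auto
    then show ?thesis using Fa Gb by simp
  next
    case False
    then have "y \<in> \<Union>(B ` I)" using B(3) that by auto
    then obtain i where i: "i \<in> I" "y \<in> B i" by auto
    then have "F (G y) = h i (g i y)" using G [OF i] F [OF i(1) GA [OF i]] by simp
    then show ?thesis using hg [OF i(1)] i topB by (auto simp: homeomorphic_maps_def)
  qed
  ultimately have "homeomorphic_maps X Y F G"
    by (simp add: homeomorphic_maps_def)
  then show thesis
    using that [OF homeomorphic_maps_imp_map F Fa] by blast
qed

corollary homeomorphic_map_two_blocks:
  assumes X: "clopenin X A" "clopenin X A'" "A \<inter> A' = {}" "topspace X = A \<union> A'"
    and Y: "clopenin Y B" "clopenin Y B'" "B \<inter> B' = {}" "topspace Y = B \<union> B'"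
    and h: "homeomorphic_map (subtopology X A) (subtopology Y B) h"
      "homeomorphic_map (subtopology X A') (subtopology Y B') h'"
  obtains F where "homeomorphic_map X Y F" "\<And>x. x \<in> A \<Longrightarrow> F x = h x" "\<And>x. x \<in> A' \<Longrightarrow> F x = h' x"
proof -
  let ?AA = "\<lambda>i. if i then A else A'" and ?BB = "\<lambda>i. if i then B else B'"
  obtain F where "homeomorphic_map X Y F"
      "\<And>i x. i \<in> UNIV \<Longrightarrow> x \<in> ?AA i \<Longrightarrow> F x = (if i then h else h') x"
    \<comment> \<open>The two blocks are indexed by the Booleans and cover everything. Both
      remainders are empty, so the points \<open>undefined\<close> are mere placeholders and the
      convergence conditions are vacuous.\<close>
    by (rule homeomorphic_map_blocks [of UNIV X ?AA "{}" undefined Y ?BB "{}" undefined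
          "\<lambda>i. if i then h else h'"])
      (use X Y h in \<open>auto simp: disjoint_family_on_def UNIV_bool\<close>)
  then show thesis
    using that [of F] by (metis UNIV_I)
qed

section \<open>Clopen copies of a space near a maximally stable point\<close>

definition clopen_copy :: "'a topology \<Rightarrow> 'a set \<Rightarrow> bool" where
  "clopen_copy E A \<longleftrightarrow> clopenin E A \<and> E homeomorphic_space subtopology E A"

lemma clopen_copy_imp_clopenin: "clopen_copy E A \<Longrightarrow> clopenin E A"
  by (simp add: clopen_copy_def)

lemma clopen_copyE:
  assumes "clopen_copy E A"
  obtains h where "homeomorphic_map E (subtopology E A) h"
  using assms by (auto simp: clopen_copy_def homeomorphic_space)

lemma clopen_copyI:
  assumes "clopenin E A" "homeomorphic_map E (subtopology E A) h"
  shows "clopen_copy E A"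
  using assms by (auto simp: clopen_copy_def homeomorphic_space)

lemma clopen_copy_image:
  assumes h: "homeomorphic_map E (subtopology E A) h" "clopenin E A" and B: "clopen_copy E B"
  shows "clopen_copy E (h ` B)"
proof -
  note * = clopenin_homeomorphic_image_subtopology [OF h clopen_copy_imp_clopenin [OF B]]
  have "E homeomorphic_space subtopology E (h ` B)"
    using B homeomorphic_map_imp_homeomorphic_space [OF *(3)] homeomorphic_space_trans
    unfolding clopen_copy_def by blast
  then show ?thesis
    using * by (simp add: clopen_copy_def)
qed

lemma homeomorphic_clopen_copies:
  assumes "clopen_copy E A" "clopen_copy E B"
  obtains h where "homeomorphic_map (subtopology E A) (subtopology E B) h"
  using assms unfolding clopen_copy_def
  by (meson homeomorphic_space homeomorphic_space_sym homeomorphic_space_trans)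

text \<open>All four sets are homeomorphic to \<open>E\<close>, so a map from \<open>D\<close> to
  \<open>D'\<close> and one between the complements can be glued. Conjugation by
  \<open>\<tau>\<close> then carries maps supported on \<open>D\<close> to maps supported on
  \<open>D'\<close>.\<close>

lemma homeomorphic_map_between_clopen_copies:
  assumes "clopen_copy E D" "clopen_copy E (topspace E - D)"
    "clopen_copy E D'" "clopen_copy E (topspace E - D')"
  obtains \<tau> where "homeomorphic_map E E \<tau>" "\<tau> ` D = D'"
proof -
  obtain h h' where h: "homeomorphic_map (subtopology E D) (subtopology E D') h"
      and h': "homeomorphic_map (subtopology E (topspace E - D)) (subtopology E (topspace E - D')) h'"
    using assms homeomorphic_clopen_copies by metis
  have D: "clopenin E D" "clopenin E D'" "D \<subseteq> topspace E" "D' \<subseteq> topspace E"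
    using assms(1,3)[THEN clopen_copy_imp_clopenin] clopenin_subset by auto
  obtain F where F: "homeomorphic_map E E F" "\<And>x. x \<in> D \<Longrightarrow> F x = h x"
    by (rule homeomorphic_map_two_blocks [of E D "topspace E - D" E D' "topspace E - D'" h h'])
      (use D h h' in \<open>auto intro: clopenin_Diff\<close>)
  have "F ` D = h ` D"
    using F(2) by auto
  also have "\<dots> = D'"
    using homeomorphic_imp_surjective_map [OF h] D by (simp add: Int_absorb1)
  finally show thesis
    using that F(1) by blast
qed

section \<open>Small clopen neighbourhoods of a moved maximally stable point\<close>

locale moved_stable_point =
  fixes E :: "'a topology" and f :: "'a \<Rightarrow> 'a" and e :: 'a
  assumes hausdorff: "Hausdorff_space E" and first_countable: "first_countable E"
    and stable: "maximally_stable E e"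
    and homeo: "homeomorphic_map E E f" and moved: "f e \<noteq> e"
begin

lemma e_in: "e \<in> topspace E"
  using stable by (simp add: maximally_stable_def)

text \<open>The members of the neighbourhood basis are pairwise homeomorphic and the whole space is
  one of them, so each of them is a copy of \<open>E\<close>.\<close>

lemma stable_nhd:
  assumes "openin E W" "e \<in> W"
  obtains B where "clopen_copy E B" "e \<in> B" "B \<subseteq> W"
proof -
  obtain \<B> where \<B>: "\<forall>B \<in> \<B>. closedin E B \<and> openin E B \<and> e \<in> B"
      "\<forall>W. openin E W \<and> e \<in> W \<longrightarrow> (\<exists>B \<in> \<B>. B \<subseteq> W)"
      "\<forall>B \<in> \<B>. \<forall>B' \<in> \<B>. subtopology E B homeomorphic_space subtopology E B'"
      "topspace E \<in> \<B>"
    using stable unfolding maximally_stable_def by blast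
  then obtain B where B: "B \<in> \<B>" "B \<subseteq> W"
    using assms by blast
  then have "E homeomorphic_space subtopology E B"
    using \<B>(3,4) by fastforce
  with B \<B>(1) show thesis
    by (intro that [of B]) (auto simp: clopen_copy_def clopenin_def)
qed

text \<open>Separate \<open>e\<close> from \<open>f e\<close> by disjoint open sets \<open>U\<close>
  and \<open>V\<close> and shrink to a copy \<open>L\<close> inside \<open>U\<close> that
  \<open>f\<close> sends into \<open>V\<close>. The image of a copy under the homeomorphism
  \<open>f\<close> is again a copy.\<close>

lemma displaced_nhd:
  obtains L where "clopen_copy E L" "e \<in> L" "f ` L \<inter> L = {}" "clopen_copy E (f ` L)"
proof -
  have "f e \<in> topspace E"
    using e_in homeo homeomorphic_imp_surjective_map by fastforce
  then obtain U V where UV: "openin E U" "openin E V" "e \<in> U" "f e \<in> V" "disjnt U V"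
    using hausdorff e_in moved unfolding Hausdorff_space_def by metis
  have "openin E {x \<in> topspace E. f x \<in> V}"
    using homeo UV(2) homeomorphic_imp_continuous_map openin_continuous_map_preimage by blast
  then have "openin E (U \<inter> {x \<in> topspace E. f x \<in> V})"
    using UV(1) by blast
  then obtain L where L: "clopen_copy E L" "e \<in> L" "L \<subseteq> U \<inter> {x \<in> topspace E. f x \<in> V}"
    using stable_nhd UV e_in by (metis (mono_tags, lifting) IntI mem_Collect_eq)
  have "clopen_copy E (f ` L)"
    using clopen_copy_image [of E "topspace E" f L] homeo L(1) by simp
  then show thesis
    using that L UV(5) by (auto simp: disjnt_iff)
qed

lemma disjoint_clopen_copies_within:
  assumes "clopen_copy E C"
  obtains C1 C2 where "clopen_copy E C1" "clopen_copy E C2" "C1 \<inter> C2 = {}" "C1 \<subseteq> C" "C2 \<subseteq> C"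
proof -
  obtain h where h: "homeomorphic_map E (subtopology E C) h"
    using assms clopen_copyE by blast
  have C: "clopenin E C"
    using assms clopen_copy_imp_clopenin by blast
  obtain L where L: "clopen_copy E L" "f ` L \<inter> L = {}" "clopen_copy E (f ` L)"
    using displaced_nhd by blast
  note copies = L(1,3)[THEN clopen_copy_image [OF h C]]
  have sub: "h ` L \<subseteq> C" "h ` f ` L \<subseteq> C"
    using L(1,3)[THEN clopen_copy_imp_clopenin, THEN clopenin_homeomorphic_image_subtopology(2) [OF h C]] .
  have "L \<subseteq> topspace E" "f ` L \<subseteq> topspace E"
    using L(1,3) clopen_copy_imp_clopenin clopenin_subset by blast+
  then have "h ` (L \<inter> f ` L) = h ` L \<inter> h ` f ` L"
    by (intro inj_on_image_Int [OF homeomorphic_imp_injective_map [OF h]])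
  moreover have "L \<inter> f ` L = {}"
    using L(2) by blast
  ultimately have "h ` L \<inter> h ` f ` L = {}"
    by simp
  then show thesis
    using that copies sub by blast
qed

text \<open>Of two disjoint copies inside a copy \<open>B\<close> around \<open>e\<close>, at most
  one contains \<open>e\<close>. If \<open>C1\<close> does, it becomes the new neighbourhood and
  \<open>C2\<close> is left over; otherwise \<open>C1\<close> is cut out of
  \<open>B\<close>.\<close>

lemma smaller_nhd:
  assumes "openin E W" "e \<in> W"
  obtains V C where "clopenin E V" "e \<in> V" "V \<subseteq> W" "clopen_copy E C" "C \<subseteq> W - V"
proof -
  obtain B where B: "clopen_copy E B" "e \<in> B" "B \<subseteq> W"
    using stable_nhd assms by blast
  obtain C1 C2 where C: "clopen_copy E C1" "clopen_copy E C2" "C1 \<inter> C2 = {}" "C1 \<subseteq> B" "C2 \<subseteq> B"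
    using disjoint_clopen_copies_within B(1) by blast
  show thesis
  proof (cases "e \<in> C1")
    case True
    then show ?thesis
      using that [of C1 C2] B C clopen_copy_imp_clopenin by blast
  next
    case False
    have "clopenin E (B - C1)"
      using B(1) C(1) clopen_copy_imp_clopenin clopenin_Diff by blast
    then show ?thesis
      using that [of "B - C1" C1] False B C by blast
  qed
qed

text \<open>Iterating \<open>smaller_nhd\<close> along a countable neighbourhood base gives
  decreasing clopen sets that shrink to \<open>e\<close>. The shells are their successive
  differences, and each step leaves a copy of \<open>E\<close> behind.\<close>

lemma shells:
  assumes W: "clopenin E W" "e \<in> W"
  obtains D C :: "nat \<Rightarrow> 'a set" where "\<And>n. clopenin E (D n)" "disjoint_family D"
    "W = insert e (\<Union>n. D n)" "e \<notin> (\<Union>n. D n)" "\<And>n. clopen_copy E (C n)" "\<And>n. C n \<subseteq> D n"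
    "\<And>V. openin E V \<Longrightarrow> e \<in> V \<Longrightarrow> finite {n. \<not> D n \<subseteq> V}"
proof -
  obtain \<B> where \<B>: "countable \<B>" "\<forall>V \<in> \<B>. openin E V"
      "\<forall>U. openin E U \<and> e \<in> U \<longrightarrow> (\<exists>V \<in> \<B>. e \<in> V \<and> V \<subseteq> U)"
    using first_countable e_in unfolding first_countable_def by metis
  define \<B>' where "\<B>' = {V \<in> \<B>. e \<in> V}"
  have "\<B>' \<noteq> {}"
    using \<B>(3) e_in openin_topspace unfolding \<B>'_def by blast
  moreover have "countable \<B>'"
    using \<B>(1) by (simp add: \<B>'_def)
  ultimately have range: "range (from_nat_into \<B>') = \<B>'"
    by simp
  then have basis: "openin E (from_nat_into \<B>' n)" "e \<in> from_nat_into \<B>' n" for n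
    using \<B>(2) rangeI [of "from_nat_into \<B>'" n] by (auto simp: \<B>'_def)
  \<comment> \<open>The clause for \<open>n = 0\<close> pins the start of the sequence to
    \<open>W\<close>. Staying inside the \<open>n\<close>-th basic set at step \<open>n\<close>
    forces convergence to \<open>e\<close>.\<close>
  have "\<exists>U. \<forall>n. (clopenin E (U n) \<and> e \<in> U n \<and> (n = 0 \<longrightarrow> U n = W)) \<and>
      (U (Suc n) \<subseteq> U n \<inter> from_nat_into \<B>' n \<and> (\<exists>C. clopen_copy E C \<and> C \<subseteq> U n - U (Suc n)))"
  proof (rule dependent_nat_choice)
    show "\<exists>U. clopenin E U \<and> e \<in> U \<and> (0 = 0 \<longrightarrow> U = W)"
      using W by blast
    fix U and n :: nat
    assume "clopenin E U \<and> e \<in> U \<and> (n = 0 \<longrightarrow> U = W)"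
    then have "openin E (U \<inter> from_nat_into \<B>' n)" "e \<in> U \<inter> from_nat_into \<B>' n"
      using basis by (auto simp: clopenin_def)
    then obtain V C where "clopenin E V" "e \<in> V" "V \<subseteq> U \<inter> from_nat_into \<B>' n"
        "clopen_copy E C" "C \<subseteq> U \<inter> from_nat_into \<B>' n - V"
      using smaller_nhd by blast
    then show "\<exists>V. (clopenin E V \<and> e \<in> V \<and> (Suc n = 0 \<longrightarrow> V = W)) \<and>
        (V \<subseteq> U \<inter> from_nat_into \<B>' n \<and> (\<exists>C. clopen_copy E C \<and> C \<subseteq> U - V))"
      by blast
  qed
  then obtain U where "\<forall>n. (clopenin E (U n) \<and> e \<in> U n \<and> (n = 0 \<longrightarrow> U n = W)) \<and>
      (U (Suc n) \<subseteq> U n \<inter> from_nat_into \<B>' n \<and> (\<exists>C. clopen_copy E C \<and> C \<subseteq> U n - U (Suc n)))"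
    by blast
  then have U: "\<And>n. clopenin E (U n)" "\<And>n. e \<in> U n" "U 0 = W"
      "\<And>n. U (Suc n) \<subseteq> U n" "\<And>n. U (Suc n) \<subseteq> from_nat_into \<B>' n"
      "\<And>n. \<exists>C. clopen_copy E C \<and> C \<subseteq> U n - U (Suc n)"
    by blast+
  then obtain C where C: "\<And>n. clopen_copy E (C n)" "\<And>n. C n \<subseteq> U n - U (Suc n)"
    by metis
  have anti: "U n \<subseteq> U m" if "m \<le> n" for m n
    by (rule lift_Suc_antimono_le [of U]) (use U(4) that in auto)
  have conv: "\<exists>n. U n \<subseteq> V" if V: "openin E V" "e \<in> V" for V
  proof -
    obtain V' where V': "V' \<in> \<B>" "e \<in> V'" "V' \<subseteq> V"
      using \<B>(3) [rule_format, OF conjI [OF V]] by blast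
    then have "V' \<in> range (from_nat_into \<B>')"
      unfolding range by (simp add: \<B>'_def)
    then obtain n where "V' = from_nat_into \<B>' n"
      by blast
    then have "U (Suc n) \<subseteq> V"
      using U(5) [of n] V'(3) by simp
    then show ?thesis ..
  qed
  define D where "D n = U n - U (Suc n)" for n
  show thesis
  proof (rule that [of D C])
    show "clopenin E (D n)" for n
      by (simp add: D_def U clopenin_Diff)
    have "D m \<inter> D n = {}" if "m < n" for m n
      using anti [of "Suc m" n] that by (auto simp: D_def)
    then show "disjoint_family D"
      by (metis Int_commute disjoint_family_on_def linorder_neqE_nat)
    show "W = insert e (\<Union>n. D n)"
    proof
      show "W \<subseteq> insert e (\<Union>n. D n)"
      proof
        fix x assume x: "x \<in> W"
        show "x \<in> insert e (\<Union>n. D n)"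
        proof (cases "x = e")
          case False
          have "x \<in> topspace E"
            using x W clopenin_subset by blast
          then obtain V V' where "openin E V" "e \<in> V" "x \<in> V'" "disjnt V V'"
            using hausdorff e_in False unfolding Hausdorff_space_def by metis
          then obtain n where "x \<notin> U n"
            using conv by (metis disjnt_iff subsetD)
          \<comment> \<open>The least index at which \<open>x\<close> has dropped out is positive
            because \<open>U 0 = W\<close> contains \<open>x\<close>; its predecessor
            \<open>m\<close> names the shell of \<open>x\<close>.\<close>
          define k where "k = (LEAST n. x \<notin> U n)"
          have k: "x \<notin> U k"
            unfolding k_def using \<open>x \<notin> U n\<close> by (rule LeastI)
          then obtain m where m: "k = Suc m"
            using x U(3) by (metis not0_implies_Suc)
          then have "x \<in> U m"
            using not_less_Least [of m "\<lambda>n. x \<notin> U n"] by (auto simp: k_def)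
          then show ?thesis
            using k m by (auto simp: D_def)
        qed auto
      qed
      show "insert e (\<Union>n. D n) \<subseteq> W"
        using anti [of 0] U(3) W by (auto simp: D_def)
    qed
    show "e \<notin> (\<Union>n. D n)"
      using U(2) by (auto simp: D_def)
    show "finite {n. \<not> D n \<subseteq> V}" if V: "openin E V" "e \<in> V" for V
    proof -
      obtain m where "U m \<subseteq> V"
        using conv V by blast
      then have "{n. \<not> D n \<subseteq> V} \<subseteq> {..<m}"
        using anti by (fastforce simp: D_def not_less)
      then show ?thesis
        using finite_subset by blast
    qed
  qed (use C in \<open>auto simp: D_def\<close>)
qed

section \<open>Absorbing clopen sets into neighbourhoods of the stable point\<close>

text \<open>
  Hilbert's hotel: inside the shells around \<^term>\<open>e\<close> there are copies \<open>X\<^sub>1, X\<^sub>2, \<dots>\<close> of \<^term>\<open>X\<close>;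
  shift \<open>X\<^sub>n\<close> to \<open>X\<^sub>n\<^sub>+\<^sub>1\<close>, starting with \<open>X\<^sub>0 = X\<close>.
\<close>

lemma absorb_clopenin:
  assumes W: "clopenin E W" "e \<in> W" and X: "clopenin E X" "X \<inter> W = {}"
  shows "subtopology E (W \<union> X) homeomorphic_space subtopology E W"
proof -
  obtain D C :: "nat \<Rightarrow> 'a set" where D: "\<And>n. clopenin E (D n)" "disjoint_family D"
      "W = insert e (\<Union>n. D n)" "e \<notin> (\<Union>n. D n)"
      "\<And>V. openin E V \<Longrightarrow> e \<in> V \<Longrightarrow> finite {n. \<not> D n \<subseteq> V}"
    and C: "\<And>n. clopen_copy E (C n)" "\<And>n. C n \<subseteq> D n"
    using shells [OF W] by metis
  have "\<forall>n. \<exists>c. homeomorphic_map E (subtopology E (C n)) c"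
    using C(1) by (meson clopen_copyE)
  then obtain c where c: "\<And>n. homeomorphic_map E (subtopology E (C n)) (c n)"
    by metis
  \<comment> \<open>The set \<open>X\<close> itself, followed by its image under the embedding of
    \<open>E\<close> into the copy \<open>C m\<close> inside the shell \<open>D m\<close>. The index
    is off by one: \<open>Xs (Suc m)\<close> lies in shell \<open>m\<close>.\<close>
  define Xs where "Xs n = (case n of 0 \<Rightarrow> X | Suc m \<Rightarrow> c m ` X)" for n
  note cX = clopenin_homeomorphic_image_subtopology [OF c clopen_copy_imp_clopenin [OF C(1)] X(1)]
  have Xs: "clopenin E (Xs n)" for n
    using X cX by (auto simp: Xs_def split: nat.split)
  have XsD: "Xs (Suc n) \<subseteq> D n" for n
    using cX(2) C(2) by (force simp: Xs_def)
  have X0: "Xs 0 = X"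
    by (simp add: Xs_def)
  have "subtopology E X homeomorphic_space subtopology E (Xs n)" for n
    using cX(3) homeomorphic_map_imp_homeomorphic_space
    by (fastforce simp: Xs_def homeomorphic_space_refl split: nat.split)
  then have hXs: "subtopology E (Xs n) homeomorphic_space subtopology E (Xs (Suc n))" for n
    by (meson homeomorphic_space_sym homeomorphic_space_trans)
  have disj: "D m \<inter> D n = {}" if "m \<noteq> n" for m n
    using D(2) that by (auto simp: disjoint_family_on_def)
  have DW: "D n \<subseteq> W" for n
    using D(3) by auto
  \<comment> \<open>Indices \<open>Inl n\<close> stand for the copies of \<open>X\<close>, which
    move one place inwards; indices \<open>Inr n\<close> stand for the rest of a shell, which stays.
    Apart from \<open>e\<close>, the blocks \<open>A\<close> fill \<open>W \<union> X\<close> and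
    the blocks \<open>B\<close> fill \<open>W\<close>.\<close>
  define A where "A = case_sum Xs (\<lambda>n. D n - Xs (Suc n))"
  define B where "B = case_sum (\<lambda>n. Xs (Suc n)) (\<lambda>n. D n - Xs (Suc n))"
  have AB [simp]: "A (Inl n) = Xs n" "A (Inr n) = D n - Xs (Suc n)"
      "B (Inl n) = Xs (Suc n)" "B (Inr n) = D n - Xs (Suc n)" for n
    by (simp_all add: A_def B_def)
  have cloAB: "clopenin E (A i)" "clopenin E (B i)" for i
    using Xs clopenin_Diff [OF D(1) Xs] by (cases i; simp)+
  define shell :: "nat + nat \<Rightarrow> nat" where "shell = case_sum id id"
  have BD: "B i \<subseteq> D (shell i)" for i
    using XsD by (cases i) (auto simp: shell_def)
  have BW: "B i \<subseteq> W" for i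
    using BD DW by blast
  have eB: "e \<notin> B i" for i
    using BD D(4) by blast
  have unB: "W = {e} \<union> \<Union>(range B)"
  proof
    have "D n \<subseteq> B (Inl n) \<union> B (Inr n)" for n
      by auto
    then have "D n \<subseteq> \<Union>(range B)" for n
      by blast
    then show "W \<subseteq> {e} \<union> \<Union>(range B)"
      using D(3) by blast
    show "{e} \<union> \<Union>(range B) \<subseteq> W"
      using W BW by blast
  qed
  have disB: "B i \<inter> B j = {}" if "i \<noteq> j" for i j
  proof (cases "shell i = shell j")
    case True
    then show ?thesis
      using that by (cases i; cases j) (auto simp: shell_def)
  next
    case False
    then show ?thesis
      using disj BD by blast
  qed
  have unA: "\<Union>(range A) = X \<union> \<Union>(range B)"
  proof
    have "A i \<subseteq> X \<union> \<Union>(range B)" for i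
    proof (cases i)
      case (Inl n)
      show ?thesis
      proof (cases n)
        case (Suc m)
        then have "A i = B (Inl m)" using Inl by simp
        then show ?thesis by blast
      qed (use Inl X0 in auto)
    next
      case (Inr n)
      then have "A i = B (Inr n)" by simp
      then show ?thesis by blast
    qed
    then show "\<Union>(range A) \<subseteq> X \<union> \<Union>(range B)" by blast
    have "B i \<subseteq> \<Union>(range A)" for i
    proof (cases i)
      case (Inl n)
      then have "B i = A (Inl (Suc n))" by simp
      then show ?thesis by blast
    next
      case (Inr n)
      then have "B i = A (Inr n)" by simp
      then show ?thesis by blast
    qed
    moreover have "X = A (Inl 0)" using X0 by simp
    ultimately show "X \<union> \<Union>(range B) \<subseteq> \<Union>(range A)" by blast
  qed
  have XB: "X \<inter> B i = {}" for i
    using X(2) BW by blast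
  have disA: "A i \<inter> A j = {}" if "i \<noteq> j" for i j
  proof -
    \<comment> \<open>Apart from its first block \<open>X\<close>, the family \<open>A\<close> is a
      reindexing of \<open>B\<close>, so its disjointness follows from that of \<open>B\<close>. The
      truncated subtraction \<open>n - 1\<close> is only relevant for positive
      \<open>n\<close>.\<close>
    have shape: "A k = (if k = Inl 0 then X else B (case k of Inl n \<Rightarrow> Inl (n - 1) | Inr n \<Rightarrow> Inr n))" for k
      using X0 by (cases k) auto
    have inj: "(case i of Inl n \<Rightarrow> Inl (n - 1) | Inr n \<Rightarrow> Inr n) \<noteq> (case j of Inl n \<Rightarrow> Inl (n - 1) | Inr n \<Rightarrow> Inr n)"
      if "i \<noteq> Inl 0" "j \<noteq> Inl 0"
      using that \<open>i \<noteq> j\<close> by (auto split: sum.splits)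
    show ?thesis
      using XB disB [OF inj] \<open>i \<noteq> j\<close> unfolding shape [of i] shape [of j] by (auto simp: Int_commute)
  qed
  have "\<exists>h. homeomorphic_map (subtopology E (A i)) (subtopology E (B i)) h" for i
    unfolding homeomorphic_space [symmetric]
    using hXs by (cases i) (simp_all add: homeomorphic_space_refl)
  then obtain h where h: "\<And>i. homeomorphic_map (subtopology E (A i)) (subtopology E (B i)) (h i)"
    by metis
  have WX: "clopenin E (W \<union> X)"
    using W X clopenin_Un by blast
  have AWX: "A i \<subseteq> W \<union> X" for i
    using unA unB by blast
  obtain F where "homeomorphic_map (subtopology E (W \<union> X)) (subtopology E W) F"
  proof (rule homeomorphic_map_blocks [of "UNIV :: (nat + nat) set" "subtopology E (W \<union> X)" A "{e}" e
          "subtopology E W" B "{e}" e h])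
    have top: "topspace (subtopology E (W \<union> X)) = W \<union> X" "topspace (subtopology E W) = W"
      using clopenin_subset [OF W(1)] clopenin_subset [OF X(1)] by auto
    show "topspace (subtopology E (W \<union> X)) = {e} \<union> \<Union>(range A)"
      unfolding top using unA unB by blast
    show "topspace (subtopology E W) = {e} \<union> \<Union>(range B)"
      unfolding top using unB by blast
    show "clopenin (subtopology E (W \<union> X)) (A i)" for i
      using clopenin_subtopology [OF WX] cloAB AWX by blast
    show "clopenin (subtopology E W) (B i)" for i
      using clopenin_subtopology [OF W(1)] cloAB BW by blast
    show "homeomorphic_map (subtopology (subtopology E (W \<union> X)) (A i)) (subtopology (subtopology E W) (B i)) (h i)" for i
      using h AWX BW by (simp add: subtopology_subtopology Int_absorb1)
    show "finite {i \<in> UNIV. \<not> A i \<subseteq> V}" if "openin (subtopology E (W \<union> X)) V" "e \<in> V" for V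
    proof -
      have "openin E V"
        using that(1) WX by (simp add: openin_open_subtopology clopenin_def)
      then have fin: "finite {n. \<not> D n \<subseteq> V}"
        using D(5) that(2) by blast
      \<comment> \<open>Every block except \<open>Inl 0\<close> lies in a shell, namely
        \<open>Inl (Suc m)\<close> and \<open>Inr m\<close> in shell \<open>m\<close>, and only
        finitely many shells leave \<open>V\<close>.\<close>
      have "i \<in> insert (Inl 0) (Inl ` Suc ` {n. \<not> D n \<subseteq> V} \<union> Inr ` {n. \<not> D n \<subseteq> V})" if "\<not> A i \<subseteq> V" for i
      proof (cases i)
        case (Inl n)
        show ?thesis
        proof (cases n)
          case (Suc m)
          then have "\<not> D m \<subseteq> V"
            using that Inl XsD [of m] by auto
          then show ?thesis using Inl Suc by blast
        qed (use Inl in auto)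
      qed (use that in auto)
      then show ?thesis
        using fin by (intro finite_subset [of "{i \<in> UNIV. \<not> A i \<subseteq> V}"
            "insert (Inl 0) (Inl ` Suc ` {n. \<not> D n \<subseteq> V} \<union> Inr ` {n. \<not> D n \<subseteq> V})"]) blast+
    qed
    show "finite {i \<in> UNIV. \<not> B i \<subseteq> V}" if "openin (subtopology E W) V" "e \<in> V" for V
    proof -
      have "openin E V"
        using that(1) W by (simp add: openin_open_subtopology clopenin_def)
      then have fin: "finite {n. \<not> D n \<subseteq> V}"
        using D(5) that(2) by blast
      have "i \<in> Inl ` {n. \<not> D n \<subseteq> V} \<union> Inr ` {n. \<not> D n \<subseteq> V}" if "\<not> B i \<subseteq> V" for i
      proof -
        have "\<not> D (shell i) \<subseteq> V"
          using BD that by blast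
        then show ?thesis
          by (cases i) (auto simp: shell_def)
      qed
      then show ?thesis
        using fin by (intro finite_subset [of "{i \<in> UNIV. \<not> B i \<subseteq> V}"
            "Inl ` {n. \<not> D n \<subseteq> V} \<union> Inr ` {n. \<not> D n \<subseteq> V}"]) blast+
    qed
    show "disjoint_family A" "disjoint_family B"
      using disA disB by (auto simp: disjoint_family_on_def)
    show "{e} \<inter> \<Union>(range A) = {}"
      using unA eB X(2) W(2) by blast
    show "{e} \<inter> \<Union>(range B) = {}"
      using eB by blast
  qed auto
  then show ?thesis
    using homeomorphic_map_imp_homeomorphic_space by blast
qed

text \<open>A basic copy \<open>B\<close> of \<open>E\<close> inside \<open>W\<close> absorbs the
  clopen remainder \<open>W - B\<close>.\<close>

lemma clopen_copy_nhd:
  assumes "clopenin E W" "e \<in> W"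
  shows "clopen_copy E W"
proof -
  obtain B where B: "clopen_copy E B" "e \<in> B" "B \<subseteq> W"
    using stable_nhd assms clopenin_def by metis
  then have "subtopology E (B \<union> (W - B)) homeomorphic_space subtopology E B"
    by (intro absorb_clopenin) (auto intro: clopenin_Diff clopen_copy_imp_clopenin assms)
  then have "subtopology E W homeomorphic_space subtopology E B"
    using B(3) by (simp add: Un_absorb1)
  then show ?thesis
    using B(1) assms unfolding clopen_copy_def
    by (meson homeomorphic_space_sym homeomorphic_space_trans)
qed

lemma clopen_copy_superset:
  assumes C: "clopen_copy E C" "C \<subseteq> A" and A: "clopenin E A"
  shows "clopen_copy E A"
proof -
  obtain L where L: "clopen_copy E L" "e \<in> L" "f ` L \<inter> L = {}" "clopen_copy E (f ` L)"
    using displaced_nhd by blast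
  note clo = L(1,4)[THEN clopen_copy_imp_clopenin] C(1)[THEN clopen_copy_imp_clopenin]
  obtain r where r: "homeomorphic_map E (subtopology E (f ` L)) r"
    using L clopen_copyE by blast
  obtain l where l: "homeomorphic_map (subtopology E C) (subtopology E L) l"
    using L C homeomorphic_clopen_copies by blast
  have clAC: "clopenin E (A - C)"
    using A clo clopenin_Diff by blast
  note rX = clopenin_homeomorphic_image_subtopology [OF r clo(2) clAC]
  have disj: "r ` (A - C) \<inter> L = {}"
    using rX(2) L(3) by blast
  have clLX: "clopenin E (L \<union> r ` (A - C))"
    using clo rX clopenin_Un by blast
  obtain F where "homeomorphic_map (subtopology E A) (subtopology E (L \<union> r ` (A - C))) F"
  proof (rule homeomorphic_map_two_blocks [of "subtopology E A" C "A - C"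
        "subtopology E (L \<union> r ` (A - C))" L "r ` (A - C)" l r])
    show "homeomorphic_map (subtopology (subtopology E A) C)
        (subtopology (subtopology E (L \<union> r ` (A - C))) L) l"
      using l C(2) by (simp add: subtopology_subtopology Int_absorb1)
    show "homeomorphic_map (subtopology (subtopology E A) (A - C))
        (subtopology (subtopology E (L \<union> r ` (A - C))) (r ` (A - C))) r"
      using rX(3) by (simp add: subtopology_subtopology Int_absorb1)
    show "topspace (subtopology E A) = C \<union> (A - C)"
      using clopenin_subset [OF A] C(2) by auto
    show "topspace (subtopology E (L \<union> r ` (A - C))) = L \<union> r ` (A - C)"
      using clopenin_subset [OF clLX] by (simp add: Int_absorb1)
  qed (use clo clAC clLX rX C(2) A disj in \<open>auto simp: clopenin_subtopology\<close>)
  moreover have "clopen_copy E (L \<union> r ` (A - C))"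
    using clLX L(2) by (intro clopen_copy_nhd) auto
  ultimately show ?thesis
    using A unfolding clopen_copy_def
    by (meson homeomorphic_map_imp_homeomorphic_space homeomorphic_space_sym homeomorphic_space_trans)
qed

end

section \<open>Normal subgroups of the homeomorphism group\<close>

lemma restrict_in_homeo_group:
  assumes "homeomorphic_map E E h"
  shows "restrict h (topspace E) \<in> carrier (homeo_group E)"
proof -
  have "bij_betw h (topspace E) (topspace E)"
    using assms by (simp add: bij_betw_def homeomorphic_eq_everything_map)
  then have "restrict h (topspace E) \<in> Bij (topspace E)"
    by (simp add: Bij_def)
  moreover have "homeomorphic_map E E (restrict h (topspace E))"
    by (rule homeomorphic_map_eq [OF assms]) simp
  ultimately show ?thesis
    by (simp add: homeo_group_def)
qed

lemma homeo_group_carrierD: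
  assumes "h \<in> carrier (homeo_group E)"
  shows "homeomorphic_map E E h" and "restrict h (topspace E) = h"
  using assms by (auto simp: homeo_group_def Bij_def extensional_restrict)

lemma mult_homeo_group:
  assumes "homeomorphic_map E E g" "homeomorphic_map E E h"
  shows "restrict g (topspace E) \<otimes>\<^bsub>homeo_group E\<^esub> restrict h (topspace E)
    = restrict (g \<circ> h) (topspace E)"
proof -
  have "h x \<in> topspace E" if "x \<in> topspace E" for x
    using assms(2) that homeomorphic_imp_surjective_map by fastforce
  moreover have "restrict g (topspace E) \<in> Bij (topspace E)" "restrict h (topspace E) \<in> Bij (topspace E)"
    using assms [THEN restrict_in_homeo_group] by (auto simp: homeo_group_def)
  ultimately show ?thesis
    by (auto simp: homeo_group_def BijGroup_def compose_def)
qed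

lemma one_homeo_group: "\<one>\<^bsub>homeo_group E\<^esub> = restrict id (topspace E)"
  by (auto simp: homeo_group_def BijGroup_def)

lemma inv_homeo_group:
  assumes "homeomorphic_maps E E h h'"
  shows "inv\<^bsub>homeo_group E\<^esub> (restrict h (topspace E)) = restrict h' (topspace E)"
proof -
  interpret group "homeo_group E"
    by (rule group_homeo_group)
  have h: "homeomorphic_map E E h" "homeomorphic_map E E h'" "\<And>x. x \<in> topspace E \<Longrightarrow> h' (h x) = x"
    using assms by (auto simp: homeomorphic_maps_map)
  have "restrict h' (topspace E) \<otimes>\<^bsub>homeo_group E\<^esub> restrict h (topspace E) = \<one>\<^bsub>homeo_group E\<^esub>"
    unfolding mult_homeo_group [OF h(2,1)] one_homeo_group using h(3) by (auto intro: restrict_ext)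
  then show ?thesis
    using h by (intro inv_equality restrict_in_homeo_group)
qed

text \<open>Group elements are extensional functions. This predicate allows membership in
  \<open>N\<close> to be stated for arbitrary functions, so that compositions and inverses need no
  explicit restriction.\<close>

definition homeo_in :: "'a topology \<Rightarrow> ('a \<Rightarrow> 'a) set \<Rightarrow> ('a \<Rightarrow> 'a) \<Rightarrow> bool" where
  "homeo_in E N h \<longleftrightarrow> homeomorphic_map E E h \<and> restrict h (topspace E) \<in> N"

lemma homeo_in_cong:
  assumes "homeo_in E N h" "\<And>x. x \<in> topspace E \<Longrightarrow> g x = h x"
  shows "homeo_in E N g"
proof -
  have "restrict g (topspace E) = restrict h (topspace E)"
    using assms(2) by (rule restrict_ext)
  then show ?thesis
    using assms homeomorphic_map_eq [of E E h g] by (simp add: homeo_in_def)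
qed

locale normal_homeo_subgroup =
  fixes E :: "'a topology" and N :: "('a \<Rightarrow> 'a) set"
  assumes normal_N: "N \<lhd> homeo_group E"
begin

interpretation N: normal N "homeo_group E"
  by (rule normal_N)

lemma homeo_in_comp:
  assumes "homeo_in E N g" "homeo_in E N h"
  shows "homeo_in E N (g \<circ> h)"
  using assms subgroup.m_closed [OF N.subgroup_axioms] mult_homeo_group [of E g h]
    homeomorphic_map_compose [of E E h E g]
  by (fastforce simp: homeo_in_def)

lemma homeo_in_inverse:
  assumes "homeo_in E N h" "homeomorphic_maps E E h h'"
  shows "homeo_in E N h'"
  using assms N.m_inv_closed inv_homeo_group [OF assms(2)]
  by (metis homeo_in_def homeomorphic_maps_map)

lemma homeo_in_conj:
  assumes h: "homeo_in E N h" and k: "homeomorphic_maps E E k k'"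
  shows "homeo_in E N (k \<circ> h \<circ> k')"
proof -
  have hom: "homeomorphic_map E E k" "homeomorphic_map E E h" "homeomorphic_map E E k'"
    using h k by (auto simp: homeo_in_def homeomorphic_maps_map)
  then have kh: "homeomorphic_map E E (k \<circ> h)"
    using homeomorphic_map_compose by blast
  have "restrict k (topspace E) \<otimes>\<^bsub>homeo_group E\<^esub> restrict h (topspace E)
      \<otimes>\<^bsub>homeo_group E\<^esub> inv\<^bsub>homeo_group E\<^esub> (restrict k (topspace E)) \<in> N"
    using h hom by (intro N.inv_op_closed2 restrict_in_homeo_group) (simp_all add: homeo_in_def)
  then show ?thesis
    using mult_homeo_group [OF hom(1,2)] mult_homeo_group [OF kh hom(3)] inv_homeo_group [OF k]
      homeomorphic_map_compose [OF hom(3) kh] by (simp add: homeo_in_def)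
qed

end

text \<open>The complement of \<open>D\<close> is fixed pointwise, hence mapped onto itself, and
  bijectivity leaves \<open>D\<close> for the rest.\<close>

lemma supported_image:
  assumes g: "homeomorphic_map E E g" and D: "D \<subseteq> topspace E"
    and fix_off: "\<And>x. x \<in> topspace E - D \<Longrightarrow> g x = x"
  shows "g ` D = D"
proof -
  have "g ` (topspace E - D) = topspace E - D"
    using fix_off by auto
  moreover have "g ` (topspace E - (topspace E - D)) = g ` topspace E - g ` (topspace E - D)"
    by (rule inj_on_image_set_diff [OF homeomorphic_imp_injective_map [OF g]]) auto
  ultimately show ?thesis
    using D homeomorphic_imp_surjective_map [OF g] by (simp add: double_diff)
qed

section \<open>Anderson's commutator argument\<close>

locale moved_stable_point_normal = moved_stable_point E f e + normal_homeo_subgroup E N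
  for E :: "'a topology" and f e N +
  assumes f_in: "homeo_in E N f"
begin

text \<open>The shells around \<open>e\<close> are indexed by the integers and \<open>\<phi>\<close>
  shifts each to the next. Given \<open>g\<close> supported on shell 0, \<open>G\<close> repeats
  \<open>g\<close> on all shells with index at least 0 and is the identity on the others. Then
  \<open>G \<phi>\<close> and \<open>g \<phi> G\<close> agree on \<open>L\<close>.\<close>

lemma displaced_shift:
  obtains L D \<phi>
  where "clopen_copy E L" "clopen_copy E D" "D \<subseteq> L" "f ` L \<inter> L = {}" "clopen_copy E (f ` L)"
    "homeomorphic_map E E \<phi>" "\<And>x. x \<in> L \<Longrightarrow> \<phi> x \<in> L" "\<And>x. x \<in> topspace E - L \<Longrightarrow> \<phi> x = x"
    "\<forall>g. homeomorphic_map E E g \<and> (\<forall>x \<in> topspace E - D. g x = x) \<longrightarrow>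
      (\<exists>G. homeomorphic_map E E G \<and> (\<forall>x \<in> topspace E - L. G x = x) \<and>
           (\<forall>x \<in> L. g (\<phi> (G x)) = G (\<phi> x)))"
proof -
  obtain L where L: "clopen_copy E L" "e \<in> L" "f ` L \<inter> L = {}" "clopen_copy E (f ` L)"
    using displaced_nhd by blast
  have cloL: "clopenin E L"
    using L(1) clopen_copy_imp_clopenin by blast
  have LT: "L \<subseteq> topspace E"
    using cloL clopenin_subset by blast
  obtain S C :: "nat \<Rightarrow> 'a set" where S: "\<And>n. clopenin E (S n)" "disjoint_family S"
      "L = insert e (\<Union>n. S n)" "e \<notin> (\<Union>n. S n)" "\<And>n. clopen_copy E (C n)" "\<And>n. C n \<subseteq> S n"
      "\<And>V. openin E V \<Longrightarrow> e \<in> V \<Longrightarrow> finite {n. \<not> S n \<subseteq> V}"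
    using shells [OF cloL L(2)] by metis
  \<comment> \<open>Integer indices make the shift a bijection. The shells converge to
    \<open>e\<close> in both directions, so the shift extends continuously by fixing
    \<open>e\<close>.\<close>
  define D where "D z = S (int_encode z)" for z
  have copy: "clopen_copy E (D z)" for z
    using clopen_copy_superset [OF S(5,6,1)] by (simp add: D_def)
  have cloD: "clopenin E (D z)" for z
    using copy clopen_copy_imp_clopenin by blast
  have "range D = range S"
    unfolding D_def by (metis image_image surj_int_encode)
  then have LD: "L = insert e (\<Union>(range D))" "e \<notin> \<Union>(range D)"
    using S(3,4) by simp_all
  have DL: "D z \<subseteq> L" for z
    using LD by blast
  have DT: "D z \<subseteq> topspace E" for z
    using DL LT by blast
  have disj: "D y \<inter> D z = {}" if "y \<noteq> z" for y z
    using S(2) that by (simp add: D_def disjoint_family_on_def int_encode_eq)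
  have conv: "finite {z. \<not> D (z + c) \<subseteq> V}" if "openin E V" "e \<in> V" for V c
  proof -
    have "{z. \<not> D (z + c) \<subseteq> V} = (\<lambda>z. int_encode (z + c)) -` {n. \<not> S n \<subseteq> V}"
      by (auto simp: D_def)
    moreover have "inj (\<lambda>z. int_encode (z + c))"
      by (auto simp: inj_on_def int_encode_eq)
    ultimately show ?thesis
      using finite_vimageI [OF S(7) [OF that]] by metis
  qed
  \<comment> \<open>Common construction of both maps: it is applied with \<open>c = 1\<close> to
    obtain \<open>\<phi>\<close> and with \<open>c = 0\<close> to obtain \<open>G\<close>.\<close>
  have glue: "\<exists>F. homeomorphic_map E E F \<and> (\<forall>z. \<forall>x \<in> D z. F x = m z x) \<and>
      (\<forall>x \<in> topspace E - L. F x = x) \<and> F e = e"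
    if m: "\<And>z. homeomorphic_map (subtopology E (D z)) (subtopology E (D (z + c))) (m z)" for m c
  proof -
    \<comment> \<open>The block \<open>None\<close> is the complement of \<open>L\<close> and
      \<open>Some z\<close> is the shell translated by \<open>c\<close>. Translation permutes the
      integers, so the union of the blocks is the same for every \<open>c\<close>.\<close>
    define A where "A c i = (case i of None \<Rightarrow> topspace E - L | Some z \<Rightarrow> D (z + c))" for c i
    have clo: "clopenin E (A c i)" for c i
      using cloL cloD by (auto simp: A_def clopenin_Diff split: option.split)
    have "A c None \<inter> A c (Some z) = {}" "A c (Some z) \<inter> A c None = {}" for c z
      using DL [of "z + c"] by (auto simp: A_def)
    moreover have "A c (Some y) \<inter> A c (Some z) = {}" if "y \<noteq> z" for c y z
      using disj that by (simp add: A_def)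
    ultimately have "A c i \<inter> A c j = {}" if "i \<noteq> j" for c i j
      using that by (cases i; cases j) simp_all
    then have disA: "disjoint_family (A c)" for c
      by (simp add: disjoint_family_on_def)
    have "\<Union>(range (A c)) = (topspace E - L) \<union> \<Union>(range D)" for c
    proof -
      have "range (\<lambda>z. D (z + c)) = range D"
        by (metis image_image surj_plus_right)
      then show ?thesis
        unfolding UNIV_option_conv by (simp add: A_def image_image)
    qed
    then have un: "topspace E = {e} \<union> \<Union>(range (A c))" "{e} \<inter> \<Union>(range (A c)) = {}" for c
      using LD LT by blast+
    have convA: "finite {i \<in> UNIV. \<not> A c i \<subseteq> V}" if "openin E V" "e \<in> V" for V c
    proof (rule finite_subset)
      show "{i \<in> UNIV. \<not> A c i \<subseteq> V} \<subseteq> insert None (Some ` {z. \<not> D (z + c) \<subseteq> V})"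
        by (auto simp: A_def split: option.splits)
      show "finite (insert None (Some ` {z. \<not> D (z + c) \<subseteq> V}))"
        using conv [OF that] by simp
    qed
    define m' where "m' i = (case i of None \<Rightarrow> id | Some z \<Rightarrow> m z)" for i
    have hom: "homeomorphic_map (subtopology E (A 0 i)) (subtopology E (A c i)) (m' i)" for i
      using m by (auto simp: A_def m'_def split: option.split)
    have "\<exists>F. homeomorphic_map E E F \<and> (\<forall>i. \<forall>x \<in> A 0 i. F x = m' i x) \<and> F e = e"
      by (rule homeomorphic_map_blocks [of UNIV E "A 0" "{e}" e E "A c" "{e}" e m'])
        (rule clo disA un convA hom subset_refl refl | assumption | blast)+
    then obtain F where F: "homeomorphic_map E E F" "\<And>i x. x \<in> A 0 i \<Longrightarrow> F x = m' i x" "F e = e"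
      by metis
    show ?thesis
    proof (intro exI conjI allI ballI)
      show "F x = m z x" if "x \<in> D z" for z x
        using F(2) [of x "Some z"] that by (simp add: A_def m'_def)
      show "F x = x" if "x \<in> topspace E - L" for x
        using F(2) [of x None] that by (simp add: A_def m'_def)
    qed (use F in auto)
  qed
  have "\<forall>z. \<exists>h k. homeomorphic_maps E (subtopology E (D z)) h k"
    using copy by (meson clopen_copyE homeomorphic_map_maps)
  then obtain h k where hk: "\<And>z. homeomorphic_maps E (subtopology E (D z)) (h z) (k z)"
    by metis
  have hom_h: "homeomorphic_map E (subtopology E (D z)) (h z)"
    and hom_k: "homeomorphic_map (subtopology E (D z)) E (k z)"
    and kh: "x \<in> topspace E \<Longrightarrow> k z (h z x) = x" for z x
    using hk [of z] by (auto simp: homeomorphic_maps_map)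
  have hD: "h z x \<in> D z" if "x \<in> topspace E" for z x
    using homeomorphic_imp_surjective_map [OF hom_h] that by fastforce
  have D_cases: "\<exists>u \<in> topspace E. x = h z u" if "x \<in> D z" for x z
    using homeomorphic_imp_surjective_map [OF hom_h [of z]] that DT [of z] by (auto simp: Int_absorb1)
  \<comment> \<open>Each shell is identified with \<open>E\<close> through \<open>h z\<close>, with
    inverse \<open>k z\<close>. In these coordinates \<open>\<phi>\<close> changes only the index of
    the shell.\<close>
  have "homeomorphic_map (subtopology E (D z)) (subtopology E (D (z + 1))) (h (z + 1) \<circ> k z)" for z
    using homeomorphic_map_compose [OF hom_k hom_h] .
  from glue [OF this] obtain \<phi> where \<phi>: "homeomorphic_map E E \<phi>"
      "\<And>z x. x \<in> D z \<Longrightarrow> \<phi> x = (h (z + 1) \<circ> k z) x"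
      "\<And>x. x \<in> topspace E - L \<Longrightarrow> \<phi> x = x" "\<phi> e = e"
    by metis
  have \<phi>h: "\<phi> (h z u) = h (z + 1) u" if "u \<in> topspace E" for z u
    using \<phi>(2) [OF hD [OF that]] kh that by simp
  have \<phi>L: "\<phi> x \<in> L" if "x \<in> L" for x
    using that LD(1) D_cases \<phi>h hD DL \<phi>(4) L(2) by (metis UN_E insertE subsetD)
  have "\<exists>G. homeomorphic_map E E G \<and> (\<forall>x \<in> topspace E - L. G x = x) \<and>
      (\<forall>x \<in> L. g (\<phi> (G x)) = G (\<phi> x))"
    if g: "homeomorphic_map E E g" and g_off: "\<And>x. x \<in> topspace E - D 0 \<Longrightarrow> g x = x" for g
  proof -
    have gD: "g ` D 0 = D 0"
      using supported_image [OF g DT g_off] .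
    have gD0: "homeomorphic_map (subtopology E (D 0)) (subtopology E (D 0)) g"
      using homeomorphic_map_subtopologies [OF g, of "D 0" "D 0"] gD DT by (simp add: Int_absorb1)
    have "homeomorphic_map (subtopology E (D z)) (subtopology E (D (z + 0)))
        (if z < 0 then id else h z \<circ> (k 0 \<circ> (g \<circ> (h 0 \<circ> k z))))" for z
      using homeomorphic_map_compose [OF homeomorphic_map_compose [OF homeomorphic_map_compose
            [OF homeomorphic_map_compose [OF hom_k hom_h] gD0] hom_k] hom_h, of z z] by simp
    from glue [OF this] obtain G where G: "homeomorphic_map E E G"
      "\<And>z x. x \<in> D z \<Longrightarrow> G x = (if z < 0 then id else h z \<circ> (k 0 \<circ> (g \<circ> (h 0 \<circ> k z)))) x"
      "\<And>x. x \<in> topspace E - L \<Longrightarrow> G x = x" "G e = e"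
      by metis
    have Gneg: "G (h z u) = h z u" if "u \<in> topspace E" "z < 0" for z u
      using G(2) [OF hD [OF that(1)]] that(2) by simp
    have Gpos: "G (h z u) = h z (k 0 (g (h 0 u)))" if "u \<in> topspace E" "\<not> z < 0" for z u
      using G(2) [OF hD [OF that(1)]] kh that by simp
    have gh: "g (h z u) = h z u" if "u \<in> topspace E" "z \<noteq> 0" for z u
      using g_off hD [OF that(1), of z] disj [OF that(2)] DT by blast
    have ghT: "k 0 (g (h 0 u)) \<in> topspace E" if "u \<in> topspace E" for u
      using homeomorphic_imp_surjective_map [OF hom_k [of 0]] gD hD [OF that] DT
      by (metis Int_absorb1 image_eqI topspace_subtopology)
    have hk0: "h 0 (k 0 (g (h 0 u))) = g (h 0 u)" if "u \<in> topspace E" for u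
      using hk [of 0] gD hD [OF that, of 0] DT [of 0] by (auto simp: homeomorphic_maps_def)
    have "g (\<phi> (G x)) = G (\<phi> x)" if "x \<in> L" for x
    proof (cases "x = e")
      case True
      then show ?thesis
        using \<phi>(4) G(4) g_off [of e] e_in LD(2) by auto
    next
      case False
      then obtain z u where u: "u \<in> topspace E" "x = h z u"
        using \<open>x \<in> L\<close> LD(1) D_cases by blast
      \<comment> \<open>For \<open>z < - 1\<close> neither \<open>G\<close> nor \<open>g\<close>
        acts. For \<open>z = - 1\<close> the shift lands in shell 0, where \<open>g\<close> and
        \<open>G\<close> coincide. For \<open>z \<ge> 0\<close> it lands beyond shell 0, where
        \<open>g\<close> is the identity, and \<open>G\<close> commutes with the change of
        index.\<close>
      consider "z < - 1" | "z = - 1" | "0 \<le> z" by linarith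
      then show ?thesis
      proof cases
        case 1
        then show ?thesis
          using u by (simp add: Gneg \<phi>h gh)
      next
        case 2
        then show ?thesis
          using u by (simp add: Gneg Gpos \<phi>h hk0)
      next
        case 3
        then show ?thesis
          using u by (simp add: Gpos \<phi>h gh ghT)
      qed
    qed
    with G show ?thesis by blast
  qed
  with L copy [of 0] DL [of 0] \<phi> \<phi>L show thesis
    using that [of L "D 0" \<phi>] by blast
qed

text \<open>
  With \<open>G = \<Prod>\<^sub>n \<phi>\<^sup>n g \<phi>\<^sup>-\<^sup>n\<close> over \<open>n \<ge> 0\<close> one has \<open>g = [G, \<phi>]\<close>, and since \<^term>\<open>f\<close> displaces the
  support of \<open>G\<close> and \<open>\<phi>\<close>, this equals \<open>[[G, f], \<phi>]\<close>.
\<close>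

lemma block_supported_in:
  obtains D where "clopen_copy E D" "clopen_copy E (topspace E - D)"
    "\<And>g. homeomorphic_map E E g \<Longrightarrow> (\<And>x. x \<in> topspace E - D \<Longrightarrow> g x = x) \<Longrightarrow> homeo_in E N g"
proof -
  obtain L D \<phi> where L: "clopen_copy E L" "clopen_copy E D" "D \<subseteq> L" "f ` L \<inter> L = {}" "clopen_copy E (f ` L)"
    and \<phi>: "homeomorphic_map E E \<phi>" "\<And>x. x \<in> L \<Longrightarrow> \<phi> x \<in> L" "\<And>x. x \<in> topspace E - L \<Longrightarrow> \<phi> x = x"
    and G_ex: "\<forall>g. homeomorphic_map E E g \<and> (\<forall>x \<in> topspace E - D. g x = x) \<longrightarrow>
      (\<exists>G. homeomorphic_map E E G \<and> (\<forall>x \<in> topspace E - L. G x = x) \<and>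
           (\<forall>x \<in> L. g (\<phi> (G x)) = G (\<phi> x)))"
    by (rule displaced_shift) blast
  have LT: "L \<subseteq> topspace E" and fLT: "f ` L \<subseteq> topspace E"
    using L(1,5) clopen_copy_imp_clopenin clopenin_subset by blast+
  have "clopenin E (topspace E - D)"
    using L(2) clopen_copy_imp_clopenin clopenin_Diff clopenin_topspace by blast
  moreover have "f ` L \<subseteq> topspace E - D"
    using fLT L(3,4) by blast
  ultimately have D': "clopen_copy E (topspace E - D)"
    using clopen_copy_superset [OF L(5)] by blast
  obtain f' where f': "homeomorphic_maps E E f f'"
    using homeo homeomorphic_map_maps by blast
  obtain \<phi>' where \<phi>': "homeomorphic_maps E E \<phi> \<phi>'"
    using \<phi>(1) homeomorphic_map_maps by blast
  show thesis
  proof (rule that [OF L(2) D'])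
    fix g assume g: "homeomorphic_map E E g" "\<And>x. x \<in> topspace E - D \<Longrightarrow> g x = x"
    obtain G where G: "homeomorphic_map E E G" "\<And>x. x \<in> topspace E - L \<Longrightarrow> G x = x"
        "\<And>x. x \<in> L \<Longrightarrow> g (\<phi> (G x)) = G (\<phi> x)"
      using G_ex g by metis
    obtain G' where G': "homeomorphic_maps E E G G'"
      using G(1) homeomorphic_map_maps by blast
    have inv: "x \<in> topspace E \<Longrightarrow> f (f' x) = x" "x \<in> topspace E \<Longrightarrow> f' (f x) = x"
        "x \<in> topspace E \<Longrightarrow> \<phi> (\<phi>' x) = x"
        "x \<in> topspace E \<Longrightarrow> G (G' x) = x" "x \<in> topspace E \<Longrightarrow> G' (G x) = x" for x
      using f' \<phi>' G' by (auto simp: homeomorphic_maps_def)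
    have into: "x \<in> topspace E \<Longrightarrow> f' x \<in> topspace E" "x \<in> topspace E \<Longrightarrow> f x \<in> topspace E"
        "x \<in> topspace E \<Longrightarrow> \<phi>' x \<in> topspace E" "x \<in> topspace E \<Longrightarrow> \<phi> x \<in> topspace E"
        "x \<in> topspace E \<Longrightarrow> G x \<in> topspace E" "x \<in> topspace E \<Longrightarrow> G' x \<in> topspace E" for x
      using f' \<phi>' G' by (auto simp: homeomorphic_maps_def continuous_map_def)
    have G'_off: "G' x = x" if "x \<in> topspace E - L" for x
      using inv(5) [of x] G(2) [OF that] that by simp
    have G'L: "G' x \<in> L" if "x \<in> L" for x
    proof (rule ccontr)
      assume "G' x \<notin> L"
      then have "G (G' x) = G' x"
        using G(2) [of "G' x"] into(6) [of x] that LT by blast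
      then show False
        using inv(4) [of x] that LT \<open>G' x \<notin> L\<close> by auto
    qed
    \<comment> \<open>The commutator of \<open>G\<close> and \<open>f\<close>: a conjugate of
      \<open>f\<close> times the inverse of \<open>f\<close>, hence in \<open>N\<close> although
      nothing is known about \<open>G\<close>.\<close>
    define K where "K = G \<circ> f \<circ> G' \<circ> f'"
    have "homeo_in E N (G \<circ> f \<circ> G')"
      by (rule homeo_in_conj [OF f_in G'])
    moreover have "homeo_in E N f'"
      by (rule homeo_in_inverse [OF f_in f'])
    ultimately have K: "homeo_in E N K"
      unfolding K_def by (rule homeo_in_comp)
    then obtain K' where K': "homeomorphic_maps E E K K'"
      using homeomorphic_map_maps by (metis homeo_in_def)
    have K_on: "K x = G x" if "x \<in> L" for x
    proof -
      have "f' x \<in> topspace E - L"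
        using that LT into inv(1) [of x] L(4) by (metis DiffI IntI emptyE image_eqI subsetD)
      then show ?thesis
        using G'_off inv(1) that LT by (auto simp: K_def)
    qed
    have K_off: "K x \<in> topspace E - L" if x: "x \<in> topspace E - L" for x
    proof (cases "f' x \<in> L")
      case True
      then have "f (G' (f' x)) \<in> topspace E - L"
        using G'L L(4) fLT by blast
      then show ?thesis
        using G(2) by (simp add: K_def)
    next
      case False
      then show ?thesis
        using x G'_off [of "f' x"] into(1) [of x] inv(1) [of x] G(2) [of x] by (simp add: K_def)
    qed
    \<comment> \<open>On \<open>L\<close> this is the defining relation of \<open>G\<close>;
      elsewhere \<open>K\<close> stays off \<open>L\<close>, where \<open>\<phi>\<close> and
      \<open>g\<close> are the identity. Solving for \<open>g\<close> gives the commutator of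
      \<open>K\<close> and \<open>\<phi>\<close>, a product of \<open>K\<close> and a conjugate of
      its inverse.\<close>
    have key: "g (\<phi> (K x)) = K (\<phi> x)" if "x \<in> topspace E" for x
    proof (cases "x \<in> L")
      case True
      then show ?thesis
        using K_on \<phi>(2) G(3) by simp
    next
      case False
      then have "K x \<in> topspace E - L"
        using K_off that by blast
      then show ?thesis
        using \<phi>(3) g(2) L(3) False that by auto
    qed
    have "homeo_in E N K'"
      by (rule homeo_in_inverse [OF K K'])
    then have "homeo_in E N (K \<circ> (\<phi> \<circ> K' \<circ> \<phi>'))"
      using homeo_in_comp [OF K homeo_in_conj [OF _ \<phi>']] by blast
    moreover have "g x = (K \<circ> (\<phi> \<circ> K' \<circ> \<phi>')) x" if "x \<in> topspace E" for x
    proof -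
      have "K' (\<phi>' x) \<in> topspace E" "K (K' (\<phi>' x)) = \<phi>' x"
        using K' into(3) [OF that] by (auto simp: homeomorphic_maps_def continuous_map_def)
      then show ?thesis
        using key [of "K' (\<phi>' x)"] inv(3) [OF that] by simp
    qed
    ultimately show "homeo_in E N g"
      by (rule homeo_in_cong)
  qed
qed

text \<open>Conjugation by a homeomorphism carrying \<open>D\<close> to the particular set of
  \<open>block_supported_in\<close> reduces the claim to that set, and \<open>N\<close> is closed
  under conjugation.\<close>

lemma supported_in:
  assumes D: "clopen_copy E D" "clopen_copy E (topspace E - D)"
    and g: "homeomorphic_map E E g" "\<And>x. x \<in> topspace E - D \<Longrightarrow> g x = x"
  shows "homeo_in E N g"
proof -
  obtain D0 where D0: "clopen_copy E D0" "clopen_copy E (topspace E - D0)"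
    and in_N: "\<And>g. homeomorphic_map E E g \<Longrightarrow> (\<And>x. x \<in> topspace E - D0 \<Longrightarrow> g x = x) \<Longrightarrow> homeo_in E N g"
    using block_supported_in by metis
  obtain \<tau> where \<tau>: "homeomorphic_map E E \<tau>" "\<tau> ` D = D0"
    using homeomorphic_map_between_clopen_copies [OF D D0] by blast
  then obtain \<tau>' where \<tau>': "homeomorphic_maps E E \<tau> \<tau>'"
    using homeomorphic_map_maps by blast
  have inv: "x \<in> topspace E \<Longrightarrow> \<tau> (\<tau>' x) = x" "x \<in> topspace E \<Longrightarrow> \<tau>' (\<tau> x) = x"
      "x \<in> topspace E \<Longrightarrow> \<tau>' x \<in> topspace E" "x \<in> topspace E \<Longrightarrow> \<tau> x \<in> topspace E"
      "x \<in> topspace E \<Longrightarrow> g x \<in> topspace E" for x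
    using \<tau>' homeomorphic_imp_surjective_map [OF g(1)]
    by (auto simp: homeomorphic_maps_def continuous_map_def)
  have "homeo_in E N (\<tau> \<circ> g \<circ> \<tau>')"
  proof (rule in_N)
    have "homeomorphic_map E E \<tau>'"
      using \<tau>' homeomorphic_maps_map by blast
    then show "homeomorphic_map E E (\<tau> \<circ> g \<circ> \<tau>')"
      using \<tau>(1) g(1) homeomorphic_map_compose by blast
    fix x assume x: "x \<in> topspace E - D0"
    then have "\<tau>' x \<notin> D"
      using \<tau>(2) inv(1) [of x] by (metis DiffE image_eqI)
    then show "(\<tau> \<circ> g \<circ> \<tau>') x = x"
      using g(2) [of "\<tau>' x"] inv x by simp
  qed
  moreover have "homeomorphic_maps E E \<tau>' \<tau>"
    using \<tau>' homeomorphic_maps_sym by blast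
  ultimately have "homeo_in E N (\<tau>' \<circ> (\<tau> \<circ> g \<circ> \<tau>') \<circ> \<tau>)"
    by (rule homeo_in_conj)
  then show ?thesis
    by (rule homeo_in_cong) (simp add: inv)
qed

text \<open>Find \<open>h\<close> that agrees with \<open>g\<close> on a clopen neighbourhood
  \<open>A\<close> of \<open>e\<close> and is the identity on some copy of \<open>E\<close>. Then
  \<open>g\<close> is \<open>h\<close> composed with \<open>h' \<circ> g\<close>, and
  \<open>supported_in\<close> applies to both factors.\<close>

lemma all_in:
  assumes g: "homeomorphic_map E E g"
  shows "homeo_in E N g"
proof -
  obtain g' where g': "homeomorphic_maps E E g g'"
    using g homeomorphic_map_maps by blast
  have ge: "g e \<in> topspace E"
    using g e_in homeomorphic_imp_surjective_map by fastforce
  \<comment> \<open>Three pairwise disjoint copies and only two points \<open>e\<close> and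
    \<open>g e\<close> to avoid, so one of the copies contains neither.\<close>
  obtain T1 R T2 T3 where T: "clopen_copy E T1" "clopen_copy E R" "T1 \<inter> R = {}"
      "clopen_copy E T2" "clopen_copy E T3" "T2 \<inter> T3 = {}" "T2 \<subseteq> R" "T3 \<subseteq> R"
    using displaced_nhd disjoint_clopen_copies_within by (metis Int_commute)
  obtain C where C: "clopen_copy E C" "e \<notin> C" "g e \<notin> C"
  proof -
    have "T1 \<inter> T2 = {}" "T1 \<inter> T3 = {}"
      using T(3,7,8) by auto
    then show thesis
      using that [OF T(1)] that [OF T(4)] that [OF T(5)] T(6) by auto
  qed
  \<comment> \<open>The half \<open>C2\<close> is where \<open>h\<close> will be the identity. The
    half \<open>C1\<close> lies in \<open>P\<close> but outside \<open>A\<close> and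
    \<open>g\<close> A\<open>, which makes both differences\<close>P - A\<open>and\<close>P - g
    \<open>A\<close> copies of \<open>E\<close>.\<close>
  obtain C1 C2 where C12: "clopen_copy E C1" "clopen_copy E C2" "C1 \<inter> C2 = {}" "C1 \<subseteq> C" "C2 \<subseteq> C"
    using disjoint_clopen_copies_within [OF C(1)] by metis
  note clo = C(1) [THEN clopen_copy_imp_clopenin] C12(1,2) [THEN clopen_copy_imp_clopenin]
  define P where "P = topspace E - C2"
  define A where "A = {x \<in> topspace E - C. g x \<in> topspace E - C}"
  have cloP: "clopenin E P"
    using clo by (simp add: P_def clopenin_Diff)
  have C2P: "topspace E - P = C2"
    using clopenin_subset [OF clo(3)] by (auto simp: P_def)
  have inv: "x \<in> topspace E \<Longrightarrow> g (g' x) = x" "x \<in> topspace E \<Longrightarrow> g' (g x) = x"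
      "x \<in> topspace E \<Longrightarrow> g' x \<in> topspace E" "x \<in> topspace E \<Longrightarrow> g x \<in> topspace E" for x
    using g' by (auto simp: homeomorphic_maps_def continuous_map_def)
  \<comment> \<open>The preimage under \<open>g\<close> is written as an image under
    \<open>g'\<close>, so that clopenness transfers along a homeomorphism.\<close>
  have "A = (topspace E - C) \<inter> g' ` (topspace E - C)"
    using inv by (auto simp: A_def intro: rev_image_eqI)
  moreover have "homeomorphic_map E E g'"
    using g' homeomorphic_maps_map by blast
  ultimately have cloA: "clopenin E A"
    using clopenin_homeomorphic_image clopenin_Int clopenin_Diff clo(1) clopenin_topspace by metis
  have cloB: "clopenin E (g ` A)"
    using clopenin_homeomorphic_image [OF g cloA] .
  have "e \<in> A"
    using e_in ge C by (simp add: A_def)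
  then have copyA: "clopen_copy E A"
    using clopen_copy_nhd [OF cloA] by blast
  have sub: "A \<subseteq> P" "g ` A \<subseteq> P" "C1 \<subseteq> P - A" "C1 \<subseteq> P - g ` A"
    using C12(3-5) clopenin_subset [OF clo(2)] by (auto simp: A_def P_def)
  have copyPA: "clopen_copy E (P - A)" and copyPB: "clopen_copy E (P - g ` A)"
    using clopen_copy_superset [OF C12(1) sub(3) clopenin_Diff [OF cloP cloA]]
      clopen_copy_superset [OF C12(1) sub(4) clopenin_Diff [OF cloP cloB]] .
  obtain q where q: "homeomorphic_map (subtopology E (P - A)) (subtopology E (P - g ` A)) q"
    using homeomorphic_clopen_copies [OF copyPA copyPB] by metis
  have gA: "homeomorphic_map (subtopology E A) (subtopology E (g ` A)) g"
    using homeomorphic_map_subtopologies [OF g, of A "g ` A"] clopenin_subset [OF cloA] clopenin_subset [OF cloB]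
    by (simp add: Int_absorb1)
  \<comment> \<open>On \<open>A\<close> the map is \<open>g\<close>; on the rest of \<open>P\<close>
    any homeomorphism \<open>q\<close> between the two copies will do. Afterwards \<open>p\<close>
    is extended by the identity on \<open>C2\<close> to give \<open>h\<close>.\<close>
  obtain p where p: "homeomorphic_map (subtopology E P) (subtopology E P) p" "\<And>x. x \<in> A \<Longrightarrow> p x = g x"
  proof (rule homeomorphic_map_two_blocks [of "subtopology E P" A "P - A"
        "subtopology E P" "g ` A" "P - g ` A" g q])
    show "homeomorphic_map (subtopology (subtopology E P) A) (subtopology (subtopology E P) (g ` A)) g"
      using gA sub by (simp add: subtopology_subtopology Int_absorb1)
    show "homeomorphic_map (subtopology (subtopology E P) (P - A)) (subtopology (subtopology E P) (P - g ` A)) q"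
      using q by (simp add: subtopology_subtopology Int_absorb1)
  qed (use cloP cloA cloB sub clopenin_subset [OF cloP] in \<open>auto simp: clopenin_subtopology clopenin_Diff\<close>)
  obtain h where h: "homeomorphic_map E E h" "\<And>x. x \<in> P \<Longrightarrow> h x = p x"
      "\<And>x. x \<in> topspace E - P \<Longrightarrow> h x = id x"
    by (rule homeomorphic_map_two_blocks [of E P "topspace E - P" E P "topspace E - P" p id])
      (use cloP p clopenin_subset [OF cloP] in \<open>auto simp: clopenin_Diff\<close>)
  have "clopen_copy E P"
    using clopen_copy_superset [OF copyA sub(1) cloP] .
  then have h_in: "homeo_in E N h"
    using supported_in [of P h] h C2P C12(2) by simp
  obtain h' where h': "homeomorphic_maps E E h h'"
    using h(1) homeomorphic_map_maps by blast
  have inv_h: "x \<in> topspace E \<Longrightarrow> h (h' x) = x" "x \<in> topspace E \<Longrightarrow> h' (h x) = x" for x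
    using h' by (auto simp: homeomorphic_maps_def)
  have AT: "topspace E - (topspace E - A) = A"
    using clopenin_subset [OF cloA] by blast
  \<comment> \<open>This map fixes \<open>A\<close> pointwise, and the complement of
    \<open>A\<close> is a copy because it contains \<open>P - A\<close>.\<close>
  have "homeo_in E N (h' \<circ> g)"
  proof (rule supported_in [of "topspace E - A"])
    show "clopen_copy E (topspace E - A)"
      using clopen_copy_superset [OF copyPA, of "topspace E - A"] cloA clopenin_subset [OF cloP]
        clopenin_Diff [OF clopenin_topspace cloA] by blast
    show "clopen_copy E (topspace E - (topspace E - A))"
      using copyA AT by simp
    show "homeomorphic_map E E (h' \<circ> g)"
      using h' g homeomorphic_map_compose homeomorphic_maps_map by metis
    fix x assume "x \<in> topspace E - (topspace E - A)"
    then have "x \<in> A"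
      using AT by simp
    then have "h x = g x" "x \<in> topspace E"
      using h(2) p(2) sub(1) clopenin_subset [OF cloA] by auto
    then show "(h' \<circ> g) x = x"
      using inv_h(2) [of x] by simp
  qed
  then have "homeo_in E N (h \<circ> (h' \<circ> g))"
    by (rule homeo_in_comp [OF h_in])
  then show ?thesis
    by (rule homeo_in_cong) (simp add: inv inv_h)
qed

lemma normal_subgroup_eq_carrier: "N = carrier (homeo_group E)"
proof
  show "N \<subseteq> carrier (homeo_group E)"
    using normal_N normal_imp_subgroup subgroup.subset by blast
  show "carrier (homeo_group E) \<subseteq> N"
  proof
    fix g assume "g \<in> carrier (homeo_group E)"
    then show "g \<in> N"
      using all_in [of g] homeo_group_carrierD [of g E] by (simp add: homeo_in_def)
  qed
qed

end

section \<open>Normal generation by a homeomorphism that moves a stable point\<close>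

theorem normal_subgroup_moving_stable_point:
  assumes E: "Hausdorff_space E" "first_countable E"
    and N: "N \<lhd> homeo_group E" "f \<in> N" and e: "maximally_stable E e" "f e \<noteq> e"
  shows "N = carrier (homeo_group E)"
proof -
  have "f \<in> carrier (homeo_group E)"
    using N normal_imp_subgroup subgroup.subset by blast
  note f = homeo_group_carrierD [OF this]
  have "moved_stable_point_normal E f e N"
    by (intro moved_stable_point_normal.intro moved_stable_point.intro normal_homeo_subgroup.intro
        moved_stable_point_normal_axioms.intro) (use E N e f in \<open>auto simp: homeo_in_def\<close>)
  then show ?thesis
    by (rule moved_stable_point_normal.normal_subgroup_eq_carrier)
qed

text \<open>Every normal subgroup containing \<open>f\<close> is the full group, and the full group
  is one of them, so the intersection is the full group.\<close>

corollary normally_generates_if_moves_stable_point: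
  assumes "Hausdorff_space E" "first_countable E"
    and f: "f \<in> carrier (homeo_group E)" and e: "maximally_stable E e" "f e \<noteq> e"
  shows "normally_generates (homeo_group E) f"
proof -
  have "N = carrier (homeo_group E)" if "N \<lhd> homeo_group E" "{f} \<subseteq> N" for N
    using normal_subgroup_moving_stable_point [OF assms(1,2) that(1), of f e] e that(2) by simp
  moreover have "carrier (homeo_group E) \<lhd> homeo_group E"
    using group.normal_inv_iff [OF group_homeo_group] group.subgroup_self [OF group_homeo_group]
    by (meson group.inv_closed group.is_monoid group_homeo_group monoid.m_closed)
  ultimately show ?thesis
    using f unfolding normally_generates_def normal_closure_def by blast
qed

section \<open>The Cantor set\<close>

lemma topspace_cantor_space [simp]: "topspace cantor_space = UNIV"
  by (simp add: cantor_space_def)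

lemma metrizable_cantor_space: "metrizable_space cantor_space"
  by (simp add: cantor_space_def metrizable_space_product_topology metrizable_space_discrete_topology)

lemma continuous_map_into_cantor_space:
  "continuous_map X cantor_space f \<longleftrightarrow> (\<forall>n. continuous_map X (discrete_topology UNIV) (\<lambda>x. f x n))"
  by (simp add: cantor_space_def continuous_map_componentwise_UNIV)

lemma continuous_map_cantor_coordinate: "continuous_map cantor_space (discrete_topology UNIV) (\<lambda>x. x n)"
  unfolding cantor_space_def by (rule continuous_map_product_projection) simp

definition cylinder :: "(nat \<Rightarrow> bool) \<Rightarrow> nat \<Rightarrow> (nat \<Rightarrow> bool) set" where
  "cylinder e n = {x. \<forall>i<n. x i = e i}"

lemma clopenin_cylinder: "clopenin cantor_space (cylinder e n)"
proof -
  have clo: "clopenin cantor_space {x. x i = e i}" for i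
    using openin_continuous_map_preimage [OF continuous_map_cantor_coordinate, of "{e i}" i]
      closedin_continuous_map_preimage [OF continuous_map_cantor_coordinate, of "{e i}" i]
    by (simp add: clopenin_def)
  show ?thesis
  proof (induction n)
    case 0
    show ?case
      using clopenin_topspace [of cantor_space] by (simp add: cylinder_def)
  next
    case (Suc n)
    have "cylinder e (Suc n) = cylinder e n \<inter> {x. x n = e n}"
      by (auto simp: cylinder_def less_Suc_eq)
    then show ?case
      using clopenin_Int [OF Suc clo] by simp
  qed
qed

text \<open>Prefixing the first \<open>n\<close> entries of \<open>e\<close> and deleting the first
  \<open>n\<close> entries are mutually inverse, and both are continuous in each coordinate.\<close>

lemma cantor_space_homeomorphic_cylinder:
  "cantor_space homeomorphic_space subtopology cantor_space (cylinder e n)"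
proof -
  define p where "p x i = (if i < n then e i else x (i - n))" for x and i :: nat
  define q where "q y i = y (i + n)" for y :: "nat \<Rightarrow> bool" and i
  have "continuous_map cantor_space cantor_space p"
    unfolding continuous_map_into_cantor_space p_def
    by (auto intro: continuous_map_cantor_coordinate split: if_split)
  then have "continuous_map cantor_space (subtopology cantor_space (cylinder e n)) p"
    by (auto simp: continuous_map_in_subtopology cylinder_def p_def)
  moreover have "continuous_map (subtopology cantor_space (cylinder e n)) cantor_space q"
    unfolding continuous_map_into_cantor_space q_def
    by (blast intro: continuous_map_from_subtopology continuous_map_cantor_coordinate)
  ultimately have "homeomorphic_maps cantor_space (subtopology cantor_space (cylinder e n)) p q"
    by (auto simp: homeomorphic_maps_def p_def q_def cylinder_def fun_eq_iff)
  then show ?thesis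
    by (auto simp: homeomorphic_space_def)
qed

text \<open>A basic open box constrains only finitely many coordinates; \<open>n\<close> is a bound
  for all of them.\<close>

lemma cylinder_basis:
  assumes "openin cantor_space W" "e \<in> W"
  obtains n where "cylinder e n \<subseteq> W"
proof -
  obtain U where U: "finite {i. U i \<noteq> UNIV}" "e \<in> Pi\<^sub>E UNIV U" "Pi\<^sub>E UNIV U \<subseteq> W"
    using assms unfolding cantor_space_def openin_product_topology_alt by auto
  obtain n where n: "i < n" if "U i \<noteq> UNIV" for i
    using finite_nat_set_iff_bounded [THEN iffD1, OF U(1)] by auto
  have "x \<in> Pi\<^sub>E UNIV U" if "x \<in> cylinder e n" for x
  proof -
    have "x i \<in> U i" for i
      using U(2) n [of i] that by (cases "U i = UNIV") (auto simp: cylinder_def PiE_iff)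
    then show ?thesis by auto
  qed
  then show thesis
    using that U(3) by blast
qed

text \<open>The cylinders around \<open>e\<close> form the required basis: all are copies of the
  Cantor space, and the one of length 0 is the whole space.\<close>

lemma maximally_stable_cantor_space: "maximally_stable cantor_space e"
  unfolding maximally_stable_def
proof (intro conjI exI [of _ "range (cylinder e)"] ballI allI impI)
  fix B B' assume "B \<in> range (cylinder e)" "B' \<in> range (cylinder e)"
  then show "subtopology cantor_space B homeomorphic_space subtopology cantor_space B'"
    using cantor_space_homeomorphic_cylinder homeomorphic_space_sym homeomorphic_space_trans
    by (metis (no_types, lifting) rangeE)
next
  fix W assume "openin cantor_space W \<and> e \<in> W"
  then obtain n where "cylinder e n \<subseteq> W"
    using cylinder_basis [of W e] by metis
  then show "\<exists>B \<in> range (cylinder e). B \<subseteq> W"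
    by (intro bexI [of _ "cylinder e n"]) auto
next
  have "cylinder e 0 = UNIV"
    by (simp add: cylinder_def)
  then show "topspace cantor_space \<in> range (cylinder e)"
    by (metis rangeI topspace_cantor_space)
qed (use clopenin_cylinder in \<open>auto simp: clopenin_def cylinder_def\<close>)

lemma homeo_group_cantor_space_nontrivial:
  "carrier (homeo_group cantor_space) \<noteq> {\<one>\<^bsub>homeo_group cantor_space\<^esub>}"
proof -
  \<comment> \<open>Negating every coordinate is an involution without fixed points.\<close>
  define flip where "flip x = (\<lambda>n. \<not> x n)" for x :: "nat \<Rightarrow> bool"
  have "continuous_map cantor_space cantor_space flip"
    unfolding continuous_map_into_cantor_space flip_def
  proof
    fix n
    have "continuous_map cantor_space (discrete_topology UNIV) (Not \<circ> (\<lambda>x. x n))"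
      by (rule continuous_map_compose [OF continuous_map_cantor_coordinate]) simp
    then show "continuous_map cantor_space (discrete_topology UNIV) (\<lambda>x. \<not> x n)"
      by (simp add: o_def)
  qed
  then have "homeomorphic_map cantor_space cantor_space flip"
    by (rule homeomorphic_map_involution) (simp add: flip_def)
  then have "flip \<in> carrier (homeo_group cantor_space)"
    using restrict_in_homeo_group [of cantor_space flip] by (simp add: restrict_UNIV)
  moreover have "flip \<noteq> \<one>\<^bsub>homeo_group cantor_space\<^esub>"
    unfolding one_homeo_group by (auto simp: flip_def fun_eq_iff)
  ultimately show ?thesis by blast
qed

theorem is_simple_group_homeo_cantor_space: "is_simple_group (homeo_group cantor_space)"
  unfolding is_simple_group_def
proof (intro conjI allI impI group_homeo_group homeo_group_cantor_space_nontrivial)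
  fix N assume N: "N \<lhd> homeo_group cantor_space"
  show "N = carrier (homeo_group cantor_space) \<or> N = {\<one>\<^bsub>homeo_group cantor_space\<^esub>}"
  proof (cases "N \<subseteq> {\<one>\<^bsub>homeo_group cantor_space\<^esub>}")
    case True
    then show ?thesis
      using subgroup.one_closed [OF normal_imp_subgroup [OF N]] by blast
  next
    case False
    \<comment> \<open>The underlying set is \<open>UNIV\<close>, so the identity of the group is
      \<open>id\<close> itself. Any other element moves some point, and every point is maximally
      stable.\<close>
    then obtain f where f: "f \<in> N" "f \<noteq> id"
      by (auto simp: one_homeo_group restrict_UNIV)
    then obtain e where "f e \<noteq> e"
      by (auto simp: fun_eq_iff)
    then show ?thesis
      using normal_subgroup_moving_stable_point [OF _ _ N f(1) maximally_stable_cantor_space]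
        metrizable_cantor_space metrizable_imp_Hausdorff_space metrizable_imp_first_countable
      by blast
  qed
qed

text \<open>A second-countable Stone space is Hausdorff and first countable, which places it in the
  scope of \<open>normally_generates_if_moves_stable_point\<close>. Simplicity for the Cantor space
  is \<open>is_simple_group_homeo_cantor_space\<close>.\<close>

theorem corollary2p3:
  shows "(\<forall>E :: 'a topology. perfectly_self_similar_stone_space E \<longrightarrow>
            (\<forall>f \<in> carrier (homeo_group E).
               (\<exists>e. maximally_stable E e \<and> f e \<noteq> e) \<longrightarrow>
               normally_generates (homeo_group E) f)) \<and>
         is_simple_group (homeo_group cantor_space)"
proof (intro conjI allI impI ballI is_simple_group_homeo_cantor_space)
  fix E :: "'a topology" and f
  assume "perfectly_self_similar_stone_space E"
  then have E: "Hausdorff_space E" "first_countable E"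
    using second_countable_imp_first_countable
    by (auto simp: perfectly_self_similar_stone_space_def stone_space_def)
  assume f: "f \<in> carrier (homeo_group E)" and "\<exists>e. maximally_stable E e \<and> f e \<noteq> e"
  then obtain e where "maximally_stable E e" "f e \<noteq> e"
    by blast
  then show "normally_generates (homeo_group E) f"
    by (rule normally_generates_if_moves_stable_point [OF E f])
qed

end
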